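(* (Green's formula) Let $f\in\mathscr D(\mathcal T_{\max})$ satisfy $\mathsf B^-f\in L^1(\Gamma_-,\mu_-)$. Then $\mathsf B^+f\in L^1(\Gamma_+,\mu_+)$ and $$\int_\Omega\mathcal T_{\max}f\,d\mu=\int_{\Gamma_-}\mathsf B^-f\,d\mu_--\int_{\Gamma_+}\mathsf B^+f\,d\mu_+ .$$
   Context: Setting. $\mu$ is a positive Radon measure on $\mathbb R^N$ (a Borel measure, or the completion of one, finite on compact sets). $F:\mathbb R^N\to\mathbb R^N$ is a globally Lipschitz vector field. For $x\in\mathbb R^N$, $t\mapsto\Phi(x,t)$, $t\in\mathbb R$, is the unique global solution of $\frac{d}{dt}X(t)=F(X(t))$, $X(0)=x$. Standing assumption: $\mu(\Phi(A,t))=\mu(A)$ for every measurable $A\subset\mathbb R^N$ and $t\in\mathbb R$. $\Omega\subset\mathbb R^N$ is a (sufficiently smooth) open set. For $x\in\Omega$, $\tau_\pm(x)=\inf\{s>0:\Phi(x,\pm s)\notin\Omega\}$, with $\inf\varnothing=\infty$. The incoming ($-$) and outgoing ($+$) boundaries are $\Gamma_\pm=\{y\in\partial\Omega:\exists x\in\Omega,\ \tau_\pm(x)<\infty,\ y=\Phi(x,\pm\tau_\pm(x))\}$. For $y\in\Gamma_-$ (resp. $y\in\Gamma_+$), $\tau_+(y)$ (resp. $\tau_-(y)$) is the length of the integral curve in $\Omega$ having $y$ as left (resp. right) endpoint, i.e. $\tau_-(x)+\tau_+(x)$ for any $x\in\Omega$ with $y=\Phi(x,-\tau_-(x))$ (resp.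 $y=\Phi(x,\tau_+(x))$). Boundary measures: $\mu_\pm$ are the unique positive Borel measures on $\Gamma_\pm$ such that for all $T>0$ and $f\in L^1(\Omega\times(0,T),\mu\otimes dt)$, with $\wedge$ denoting minimum, $\int_{\Omega\times(0,T)}f\,d\mu\,dt=\int_0^Tdt\int_{\Gamma_+}d\mu_+(y)\int_0^{\tau_-(y)\wedge t}f(\Phi(y,-s),t-s)ds+\int_\Omega d\mu(x)\int_0^{\tau_-(x)\wedge T}f(\Phi(x,-s),T-s)ds$ and $\int_{\Omega\times(0,T)}f\,d\mu\,dt=\int_0^Tdt\int_{\Gamma_-}d\mu_-(y)\int_0^{\tau_+(y)\wedge(T-t)}f(\Phi(y,s),t+s)ds+\int_\Omega d\mu(x)\int_0^{\tau_+(x)\wedge T}f(\Phi(x,s),s)ds$. Support: the support of a measurable function on $\Omega$ is $\Omega\setminus\omega$, where $\omega$ is the maximal open subset of $\Omega$ on which the function vanishes $\mu$-a.e. Test functions: $\mathfrak Y$ is the set of all measurable bounded functions $\psi:\Omega\to\mathbb R$ with compact support in $\Omega$ such that for any $x\in\Omega$ the map $s\in(-\tau_-(x),\tau_+(x))\mapsto\psi(\Phi(x,s))$ is continuously differentiable, and $x\mapsto\frac{d}{ds}\psi(\Phi(x,s))|_{s=0}$ is measurable and bounded on $\Omega$. Maximal transport operator: $\mathscr D(\mathcal T_{\max})$ is the set of all $f\in L^1(\Omega,\mu)$ for which there is $g\in L^1(\Omega,\mu)$ with $\int_\Omega g\psi\,d\mu=\int_\Omega f(x)\frac{d}{ds}\psi(\Phi(x,s))|_{s=0}\,d\mu(x)$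 for all $\psi\in\mathfrak Y$; then $\mathcal T_{\max}f:=g$. Traces: each $f\in\mathscr D(\mathcal T_{\max})$ has a representative $f^\sharp$ such that for $\mu$-a.e. $x\in\Omega$ and all $-\tau_-(x)<t_1\le t_2<\tau_+(x)$, $f^\sharp(\Phi(x,t_1))-f^\sharp(\Phi(x,t_2))=\int_{t_1}^{t_2}[\mathcal T_{\max}f](\Phi(x,s))ds$; the traces are $\mathsf B^+f(y)=\lim_{t\to0+}f^\sharp(\Phi(y,-t))$ for $\mu_+$-a.e. $y\in\Gamma_+$ and $\mathsf B^-f(y)=\lim_{t\to0+}f^\sharp(\Phi(y,t))$ for $\mu_-$-a.e. $y\in\Gamma_-$ (these limits exist a.e.). *)

theory Defs
  imports "HOL-Analysis.Analysis"
begin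

definition radon_measure :: "'a::euclidean_space measure \<Rightarrow> bool" where
  "radon_measure M \<longleftrightarrow>
    (\<exists>M0. sets M0 = sets borel \<and> (\<forall>K. compact K \<longrightarrow> emeasure M0 K < \<infinity>) \<and>
          (M = M0 \<or> M = completion M0))"

(* For globally Lipschitz F the map Phi is uniquely determined by this predicate. *)
definition is_flow ::
  "('a::euclidean_space \<Rightarrow> 'a) \<Rightarrow> ('a \<Rightarrow> real \<Rightarrow> 'a) \<Rightarrow> bool" where
  "is_flow F \<Phi> \<longleftrightarrow>
    (\<forall>x. \<Phi> x 0 = x \<and> (\<forall>t. (\<Phi> x has_vector_derivative F (\<Phi> x t)) (at t)))"

definition tau_plus :: "('a::euclidean_space \<Rightarrow> real \<Rightarrow> 'a) \<Rightarrow> 'a set \<Rightarrow> 'a \<Rightarrow> ereal" where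
  "tau_plus \<Phi> \<Omega> x = Inf {ereal s | s. s > 0 \<and> \<Phi> x s \<notin> \<Omega>}"

definition tau_minus :: "('a::euclidean_space \<Rightarrow> real \<Rightarrow> 'a) \<Rightarrow> 'a set \<Rightarrow> 'a \<Rightarrow> ereal" where
  "tau_minus \<Phi> \<Omega> x = Inf {ereal s | s. s > 0 \<and> \<Phi> x (- s) \<notin> \<Omega>}"

definition Gamma_plus :: "('a::euclidean_space \<Rightarrow> real \<Rightarrow> 'a) \<Rightarrow> 'a set \<Rightarrow> 'a set" where
  "Gamma_plus \<Phi> \<Omega> =
    {y \<in> frontier \<Omega>. \<exists>x\<in>\<Omega>. tau_plus \<Phi> \<Omega> x < \<infinity> \<and>
        y = \<Phi> x (real_of_ereal (tau_plus \<Phi> \<Omega> x))}"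

definition Gamma_minus :: "('a::euclidean_space \<Rightarrow> real \<Rightarrow> 'a) \<Rightarrow> 'a set \<Rightarrow> 'a set" where
  "Gamma_minus \<Phi> \<Omega> =
    {y \<in> frontier \<Omega>. \<exists>x\<in>\<Omega>. tau_minus \<Phi> \<Omega> x < \<infinity> \<and>
        y = \<Phi> x (- real_of_ereal (tau_minus \<Phi> \<Omega> x))}"

(* The extension of tau_+ to y in Gamma_-, resp. of tau_- to y in Gamma_+: the length of the
   integral curve in Omega with left, resp. right, endpoint y. *)
definition length_from :: "('a::euclidean_space \<Rightarrow> real \<Rightarrow> 'a) \<Rightarrow> 'a set \<Rightarrow> 'a \<Rightarrow> ereal" where
  "length_from \<Phi> \<Omega> y =
    (THE l. \<exists>x\<in>\<Omega>. tau_minus \<Phi> \<Omega> x < \<infinity> \<and> y = \<Phi> x (- real_of_ereal (tau_minus \<Phi> \<Omega> x)) \<and>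
                  l = tau_minus \<Phi> \<Omega> x + tau_plus \<Phi> \<Omega> x)"

definition length_to :: "('a::euclidean_space \<Rightarrow> real \<Rightarrow> 'a) \<Rightarrow> 'a set \<Rightarrow> 'a \<Rightarrow> ereal" where
  "length_to \<Phi> \<Omega> y =
    (THE l. \<exists>x\<in>\<Omega>. tau_plus \<Phi> \<Omega> x < \<infinity> \<and> y = \<Phi> x (real_of_ereal (tau_plus \<Phi> \<Omega> x)) \<and>
                  l = tau_minus \<Phi> \<Omega> x + tau_plus \<Phi> \<Omega> x)"

(* The iterated integral of h p s over p in P and s in the open interval (0, L p) exists, the
   inner one for almost every p, and equals v.  Making existence explicit matters because the
   Bochner integral of a non-integrable function is 0.  The inner measure is lebesgue, not
   lborel: when the underlying measure is a completion, the restriction of a measurable function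
   to almost every integral curve is Lebesgue but in general not Borel measurable. *)
definition has_iterated_integral ::
  "'p measure \<Rightarrow> ('p \<Rightarrow> ereal) \<Rightarrow> ('p \<Rightarrow> real \<Rightarrow> real) \<Rightarrow> real \<Rightarrow> bool" where
  "has_iterated_integral P L h v \<longleftrightarrow>
    (AE p in P. set_integrable lebesgue {s. 0 < s \<and> ereal s < L p} (h p)) \<and>
    has_bochner_integral P (\<lambda>p. LINT s:{s. 0 < s \<and> ereal s < L p}|lebesgue. h p s) v"

(* The boundary measures are Borel measures; almost everywhere defined functions on the boundary
   are integrated against the completion, which agrees with the measure on Borel functions. *)
definition outgoing_boundary_measure ::
  "'a::euclidean_space measure \<Rightarrow> ('a \<Rightarrow> real \<Rightarrow> 'a) \<Rightarrow> 'a set \<Rightarrow> 'a measure \<Rightarrow> bool" where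
  "outgoing_boundary_measure M \<Phi> \<Omega> \<nu> \<longleftrightarrow>
    sets \<nu> = sets (restrict_space borel (Gamma_plus \<Phi> \<Omega>)) \<and>
    (\<forall>T>0. \<forall>f :: 'a \<times> real \<Rightarrow> real.
       integrable (restrict_space M \<Omega> \<Otimes>\<^sub>M restrict_space lborel {0<..<T}) f \<longrightarrow>
       (\<exists>J a b.
          (AE t in lebesgue_on {0<..<T}.
             has_iterated_integral (completion \<nu>) (\<lambda>y. min (length_to \<Phi> \<Omega> y) (ereal t))
               (\<lambda>y s. f (\<Phi> y (- s), t - s)) (J t)) \<and>
          has_bochner_integral (lebesgue_on {0<..<T}) J a \<and>
          has_iterated_integral (restrict_space M \<Omega>) (\<lambda>x. min (tau_minus \<Phi> \<Omega> x) (ereal T))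
             (\<lambda>x s. f (\<Phi> x (- s), T - s)) b \<and>
          (\<integral>z. f z \<partial>(restrict_space M \<Omega> \<Otimes>\<^sub>M restrict_space lborel {0<..<T})) = a + b))"

definition incoming_boundary_measure ::
  "'a::euclidean_space measure \<Rightarrow> ('a \<Rightarrow> real \<Rightarrow> 'a) \<Rightarrow> 'a set \<Rightarrow> 'a measure \<Rightarrow> bool" where
  "incoming_boundary_measure M \<Phi> \<Omega> \<nu> \<longleftrightarrow>
    sets \<nu> = sets (restrict_space borel (Gamma_minus \<Phi> \<Omega>)) \<and>
    (\<forall>T>0. \<forall>f :: 'a \<times> real \<Rightarrow> real.
       integrable (restrict_space M \<Omega> \<Otimes>\<^sub>M restrict_space lborel {0<..<T}) f \<longrightarrow>
       (\<exists>J a b.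
          (AE t in lebesgue_on {0<..<T}.
             has_iterated_integral (completion \<nu>) (\<lambda>y. min (length_from \<Phi> \<Omega> y) (ereal (T - t)))
               (\<lambda>y s. f (\<Phi> y s, t + s)) (J t)) \<and>
          has_bochner_integral (lebesgue_on {0<..<T}) J a \<and>
          has_iterated_integral (restrict_space M \<Omega>) (\<lambda>x. min (tau_plus \<Phi> \<Omega> x) (ereal T))
             (\<lambda>x s. f (\<Phi> x s, s)) b \<and>
          (\<integral>z. f z \<partial>(restrict_space M \<Omega> \<Otimes>\<^sub>M restrict_space lborel {0<..<T})) = a + b))"

(* The union is the maximal open subset of Omega on which psi vanishes almost everywhere. *)
definition ae_support :: "'a::euclidean_space measure \<Rightarrow> 'a set \<Rightarrow> ('a \<Rightarrow> real) \<Rightarrow> 'a set" where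
  "ae_support M \<Omega> \<psi> =
    \<Omega> - \<Union>{U. open U \<and> U \<subseteq> \<Omega> \<and> (AE x in restrict_space M \<Omega>. x \<in> U \<longrightarrow> \<psi> x = 0)}"

definition flow_deriv ::
  "('a::euclidean_space \<Rightarrow> real \<Rightarrow> 'a) \<Rightarrow> ('a \<Rightarrow> real) \<Rightarrow> 'a \<Rightarrow> real" where
  "flow_deriv \<Phi> \<psi> x = deriv (\<lambda>s. \<psi> (\<Phi> x s)) 0"

(* Functions on Omega are total functions whose values outside Omega are irrelevant. *)
definition test_functions ::
  "'a::euclidean_space measure \<Rightarrow> ('a \<Rightarrow> real \<Rightarrow> 'a) \<Rightarrow> 'a set \<Rightarrow> ('a \<Rightarrow> real) set" where
  "test_functions M \<Phi> \<Omega> =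
    {\<psi>. \<psi> \<in> borel_measurable (restrict_space M \<Omega>) \<and> bounded (\<psi> ` \<Omega>) \<and>
        compact (ae_support M \<Omega> \<psi>) \<and>
        (\<forall>x\<in>\<Omega>. (\<lambda>s. \<psi> (\<Phi> x s)) C1_differentiable_on
                 {s. - tau_minus \<Phi> \<Omega> x < ereal s \<and> ereal s < tau_plus \<Phi> \<Omega> x}) \<and>
        flow_deriv \<Phi> \<psi> \<in> borel_measurable (restrict_space M \<Omega>) \<and>
        bounded (flow_deriv \<Phi> \<psi> ` \<Omega>)}"

definition is_Tmax ::
  "'a::euclidean_space measure \<Rightarrow> ('a \<Rightarrow> real \<Rightarrow> 'a) \<Rightarrow> 'a set \<Rightarrow>
    ('a \<Rightarrow> real) \<Rightarrow> ('a \<Rightarrow> real) \<Rightarrow> bool" where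
  "is_Tmax M \<Phi> \<Omega> f g \<longleftrightarrow>
    integrable (restrict_space M \<Omega>) g \<and>
    (\<forall>\<psi>\<in>test_functions M \<Phi> \<Omega>.
       (\<integral>x. g x * \<psi> x \<partial>(restrict_space M \<Omega>)) =
       (\<integral>x. f x * flow_deriv \<Phi> \<psi> x \<partial>(restrict_space M \<Omega>)))"

definition dom_Tmax ::
  "'a::euclidean_space measure \<Rightarrow> ('a \<Rightarrow> real \<Rightarrow> 'a) \<Rightarrow> 'a set \<Rightarrow> ('a \<Rightarrow> real) set" where
  "dom_Tmax M \<Phi> \<Omega> = {f. integrable (restrict_space M \<Omega>) f \<and> (\<exists>g. is_Tmax M \<Phi> \<Omega> f g)}"

(* The function g is determined only up to null sets; Tmax picks a representative. *)
definition Tmax ::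
  "'a::euclidean_space measure \<Rightarrow> ('a \<Rightarrow> real \<Rightarrow> 'a) \<Rightarrow> 'a set \<Rightarrow> ('a \<Rightarrow> real) \<Rightarrow> ('a \<Rightarrow> real)" where
  "Tmax M \<Phi> \<Omega> f = (SOME g. is_Tmax M \<Phi> \<Omega> f g)"

definition sharp_representative ::
  "'a::euclidean_space measure \<Rightarrow> ('a \<Rightarrow> real \<Rightarrow> 'a) \<Rightarrow> 'a set \<Rightarrow>
    ('a \<Rightarrow> real) \<Rightarrow> ('a \<Rightarrow> real) \<Rightarrow> bool" where
  "sharp_representative M \<Phi> \<Omega> f fs \<longleftrightarrow>
    (AE x in restrict_space M \<Omega>. fs x = f x) \<and>
    (AE x in restrict_space M \<Omega>. \<forall>t1 t2.
       - tau_minus \<Phi> \<Omega> x < ereal t1 \<and> t1 \<le> t2 \<and> ereal t2 < tau_plus \<Phi> \<Omega> x \<longrightarrow>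
       fs (\<Phi> x t1) - fs (\<Phi> x t2) = (LINT s:{t1..t2}|lebesgue. Tmax M \<Phi> \<Omega> f (\<Phi> x s)))"

(* The traces B^+ f and B^- f, to be applied to the representative fs of f.
   Lim is unspecified at boundary points where the limit does not exist. *)
definition trace_plus ::
  "('a::euclidean_space \<Rightarrow> real \<Rightarrow> 'a) \<Rightarrow> ('a \<Rightarrow> real) \<Rightarrow> 'a \<Rightarrow> real" where
  "trace_plus \<Phi> fs y = Lim (at_right 0) (\<lambda>t. fs (\<Phi> y (- t)))"

definition trace_minus ::
  "('a::euclidean_space \<Rightarrow> real \<Rightarrow> 'a) \<Rightarrow> ('a \<Rightarrow> real) \<Rightarrow> 'a \<Rightarrow> real" where
  "trace_minus \<Phi> fs y = Lim (at_right 0) (\<lambda>t. fs (\<Phi> y t))"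

end

theory Submission
  imports Defs
begin

text \<open>
  Let \<open>g = Tmax f\<close>. Along a characteristic curve the representative \<open>fs\<close> of \<open>f\<close> has derivative
  \<open>- g\<close>, so on a single curve the formula is the fundamental theorem of calculus: the value at the
  entry point minus the value at the exit point is the integral of \<open>g\<close>. The difficulty is to sum
  this over all curves, some of them infinitely long, with two boundary measures that are linked
  only through integrals over \<open>\<Omega> \<times> (0, T)\<close>.

  Take \<open>T = 1\<close> and \<open>\<chi> t = t * (1 - t)\<close>, which vanishes at \<open>0\<close> and \<open>1\<close> and has integral \<open>1 / 6\<close>.
  Going backwards in space and time from \<open>(z, t)\<close>, where \<open>z\<close> is an outgoing boundary point or
  \<open>t = 1\<close>, the function \<open>f x * \<chi>' t - g x * \<chi> t\<close> integrates to \<open>\<chi> t\<close> times the outgoing trace at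
  \<open>z\<close>, minus \<open>\<chi> t0\<close> times the incoming trace \<open>b\<close> at the entry point if the curve entered \<open>\<Omega>\<close> at a
  time \<open>t0 > 0\<close> (\<open>integral_product_rule_open_interval\<close>). The last term is cancelled by adding a
  function \<open>u\<close> (\<open>transported b\<close>) which is constant along space-time curves: on a curve that enters
  at \<open>y\<close> at time \<open>t0\<close> it equals \<open>b y * \<chi> t0\<close> divided by the length of the curve within
  \<open>\<Omega> \<times> (0, 1)\<close>, and on curves that start inside \<open>\<Omega>\<close> at time \<open>0\<close> it is zero. By construction \<open>u\<close>
  integrates to \<open>b y * \<chi> t0\<close> along each entering curve, so the incoming formula gives
  \<open>\<integral> u = (\<integral> b d\<mu>m) / 6\<close> (\<open>integral_transported\<close>).

  The outgoing formula for \<open>w = f * \<chi>' - g * \<chi> + u\<close> now has no contribution from the curves that end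
  at time \<open>1\<close>, because \<open>\<chi> 1 = 0\<close>, and its boundary integrand is \<open>\<chi> t\<close> times the outgoing trace
  (\<open>backward_integral\<close>). Hence this trace is integrable, and since \<open>\<chi>'\<close> has integral \<open>0\<close>,
  \<open>(\<integral> b d\<mu>m - \<integral> g dM) / 6 = \<integral> w = (\<integral> (outgoing trace) d\<mu>p) / 6\<close>, which is the claim.

  The pointwise identities hold only for almost every curve. Null sets of \<open>\<Omega>\<close>, and of the incoming
  boundary, are met by almost no curve: this is the outgoing formula applied to their indicator
  function, or to the transported indicator function (\<open>null_along_outgoing\<close>).
\<close>

section \<open>Continuity and group property of the flow\<close>

text \<open>Gronwall: the squared distance of two solutions, multiplied by \<open>exp (- 2 * C * t)\<close>,
  is nonincreasing.\<close>

lemma lipschitz_ode_dist_le_nonneg: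
  fixes F :: "'a::euclidean_space \<Rightarrow> 'a"
  assumes F: "C-lipschitz_on UNIV F"
    and X: "\<And>t. (X has_vector_derivative F (X t)) (at t)"
    and Y: "\<And>t. (Y has_vector_derivative F (Y t)) (at t)"
    and t: "0 \<le> t"
  shows "dist (X t) (Y t) \<le> exp (C * t) * dist (X 0) (Y 0)"
proof -
  define D where "D s = exp (- 2 * C * s) * ((X s - Y s) \<bullet> (X s - Y s))" for s
  have der: "(D has_real_derivative
      exp (- 2 * C * s) * (2 * ((X s - Y s) \<bullet> (F (X s) - F (Y s))) - 2 * C * ((X s - Y s) \<bullet> (X s - Y s))))
      (at s)" for s
  proof -
    have "((\<lambda>s. X s - Y s) has_derivative (\<lambda>h. h *\<^sub>R (F (X s) - F (Y s)))) (at s)"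
      using has_vector_derivative_diff[OF X[of s] Y[of s]] by (simp add: has_vector_derivative_def)
    from has_derivative_inner[OF this this]
    have 1: "((\<lambda>s. (X s - Y s) \<bullet> (X s - Y s)) has_real_derivative
        2 * ((X s - Y s) \<bullet> (F (X s) - F (Y s)))) (at s)"
      unfolding has_field_derivative_def
      by (rule has_derivative_eq_rhs) (auto simp: inner_commute algebra_simps)
    show ?thesis
      unfolding D_def
      by (rule derivative_eq_intros 1 refl)+ (simp add: algebra_simps)
  qed
  have "D t \<le> D 0"
  proof (rule DERIV_nonpos_imp_nonincreasing[OF t])
    fix s
    have "(X s - Y s) \<bullet> (F (X s) - F (Y s)) \<le> norm (X s - Y s) * norm (F (X s) - F (Y s))"
      by (rule norm_cauchy_schwarz)
    also have "\<dots> \<le> norm (X s - Y s) * (C * norm (X s - Y s))"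
      using lipschitz_onD[OF F, of "X s" "Y s"] by (intro mult_left_mono) (auto simp: dist_norm)
    also have "\<dots> = C * ((X s - Y s) \<bullet> (X s - Y s))"
      by (simp add: power2_norm_eq_inner[symmetric] power2_eq_square)
    finally have "exp (- 2 * C * s) * (2 * ((X s - Y s) \<bullet> (F (X s) - F (Y s)))
        - 2 * C * ((X s - Y s) \<bullet> (X s - Y s))) \<le> 0"
      by (intro mult_nonneg_nonpos) auto
    then show "\<exists>y. (D has_real_derivative y) (at s) \<and> y \<le> 0"
      using der by blast
  qed
  then have "exp (- (2 * (C * t))) * (dist (X t) (Y t))\<^sup>2 \<le> (dist (X 0) (Y 0))\<^sup>2"
    by (simp add: D_def dist_norm power2_norm_eq_inner mult.assoc)
  then have "(dist (X t) (Y t))\<^sup>2 \<le> exp (2 * (C * t)) * (dist (X 0) (Y 0))\<^sup>2"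
    by (simp add: exp_minus field_simps)
  also have "\<dots> = (exp (C * t) * dist (X 0) (Y 0))\<^sup>2"
    by (simp add: power_mult_distrib exp_double)
  finally show ?thesis
    by (rule power2_le_imp_le) simp
qed

text \<open>Negative times follow by applying the previous estimate to the reversed curves, which solve
  the equation with right-hand side \<open>- F\<close>.\<close>

lemma lipschitz_ode_dist_le:
  fixes F :: "'a::euclidean_space \<Rightarrow> 'a"
  assumes F: "C-lipschitz_on UNIV F"
    and X: "\<And>t. (X has_vector_derivative F (X t)) (at t)"
    and Y: "\<And>t. (Y has_vector_derivative F (Y t)) (at t)"
  shows "dist (X t) (Y t) \<le> exp (C * \<bar>t\<bar>) * dist (X 0) (Y 0)"
proof (cases "0 \<le> t")
  case True
  then show ?thesis using lipschitz_ode_dist_le_nonneg[OF F X Y] by simp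
next
  case False
  have rev: "((\<lambda>t. Z (- t)) has_vector_derivative - F (Z (- t))) (at t)"
    if "\<And>t. (Z has_vector_derivative F (Z t)) (at t)" for Z t
    using vector_diff_chain_at[OF has_vector_derivative_minus[OF has_vector_derivative_id] that, of t]
    by (simp add: o_def)
  have "C-lipschitz_on UNIV (\<lambda>x. - F x)"
    using F by (simp add: lipschitz_on_minus)
  from lipschitz_ode_dist_le_nonneg[OF this, of "\<lambda>t. X (- t)" "\<lambda>t. Y (- t)" "- t"] False
  show ?thesis using rev[OF X] rev[OF Y] by simp
qed

locale flow_in_open_set =
  fixes \<Phi> :: "'a::euclidean_space \<Rightarrow> real \<Rightarrow> 'a" and \<Omega> :: "'a set"
  assumes flow_zero [simp]: "\<Phi> x 0 = x"
    and flow_flow: "\<Phi> (\<Phi> x s) t = \<Phi> x (s + t)"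
    and continuous_flow: "continuous_on UNIV (\<lambda>p. \<Phi> (fst p) (snd p))"
    and open_domain: "open \<Omega>"

text \<open>The estimate \<open>lipschitz_ode_dist_le\<close> gives uniqueness, hence the group law: both sides
  solve the same initial value problem. It also gives joint continuity, since
  \<open>\<Phi> y s\<close> is compared with \<open>\<Phi> x t\<close> through \<open>\<Phi> x s\<close>.\<close>

lemma flow_in_open_setI:
  fixes F :: "'a::euclidean_space \<Rightarrow> 'a"
  assumes F: "C-lipschitz_on UNIV F" and \<Phi>: "is_flow F \<Phi>" and "open \<Omega>"
  shows "flow_in_open_set \<Phi> \<Omega>"
proof
  have zero: "\<Phi> x 0 = x" and der: "(\<Phi> x has_vector_derivative F (\<Phi> x t)) (at t)" for x t
    using \<Phi> by (auto simp: is_flow_def)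
  note dist_le = lipschitz_ode_dist_le[OF F]
  show "\<Phi> x 0 = x" for x by (rule zero)
  show "\<Phi> (\<Phi> x s) t = \<Phi> x (s + t)" for x s t
  proof -
    have "((\<lambda>t. \<Phi> x (s + t)) has_vector_derivative F (\<Phi> x (s + t))) (at t)" for t
    proof -
      have "((\<lambda>t. s + t) has_vector_derivative 1) (at t)"
        by (auto intro!: derivative_eq_intros)
      from vector_diff_chain_at[OF this der] show ?thesis by (simp add: o_def)
    qed
    from dist_le[OF der this, of "\<Phi> x s" t] show ?thesis by (simp add: zero)
  qed
  show "continuous_on UNIV (\<lambda>p. \<Phi> (fst p) (snd p))"
    unfolding continuous_on_def
  proof (intro ballI)
    fix p :: "'a \<times> real"
    let ?l = "at p within UNIV"
    have cont: "isCont (\<Phi> (fst p)) t" for t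
      using der has_vector_derivative_continuous by blast
    have "((\<lambda>q. exp (C * \<bar>snd q\<bar>) * dist (fst q) (fst p)
        + dist (\<Phi> (fst p) (snd q)) (\<Phi> (fst p) (snd p))) \<longlongrightarrow>
        exp (C * \<bar>snd p\<bar>) * dist (fst p) (fst p)
        + dist (\<Phi> (fst p) (snd p)) (\<Phi> (fst p) (snd p))) ?l"
      by (intro tendsto_intros isCont_tendsto_compose[OF cont])
    then have "((\<lambda>q. exp (C * \<bar>snd q\<bar>) * dist (fst q) (fst p)
        + dist (\<Phi> (fst p) (snd q)) (\<Phi> (fst p) (snd p))) \<longlongrightarrow> 0) ?l"
      by simp
    then have "((\<lambda>q. dist (\<Phi> (fst q) (snd q)) (\<Phi> (fst p) (snd p))) \<longlongrightarrow> 0) ?l"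
    proof (rule tendsto_0_le[where K = 1], intro always_eventually allI)
      fix q :: "'a \<times> real"
      have "dist (\<Phi> (fst q) (snd q)) (\<Phi> (fst p) (snd p))
          \<le> dist (\<Phi> (fst q) (snd q)) (\<Phi> (fst p) (snd q))
            + dist (\<Phi> (fst p) (snd q)) (\<Phi> (fst p) (snd p))"
        by (rule dist_triangle)
      also have "\<dots> \<le> exp (C * \<bar>snd q\<bar>) * dist (fst q) (fst p)
            + dist (\<Phi> (fst p) (snd q)) (\<Phi> (fst p) (snd p))"
        using dist_le[OF der der, of "fst q" "snd q" "fst p"] by (simp add: zero)
      finally show "norm (dist (\<Phi> (fst q) (snd q)) (\<Phi> (fst p) (snd p)))
          \<le> norm (exp (C * \<bar>snd q\<bar>) * dist (fst q) (fst p)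
            + dist (\<Phi> (fst p) (snd q)) (\<Phi> (fst p) (snd p))) * 1"
        by simp
    qed
    then show "((\<lambda>p. \<Phi> (fst p) (snd p)) \<longlongrightarrow> \<Phi> (fst p) (snd p)) ?l"
      by (rule tendsto_dist_iff[THEN iffD2])
  qed
qed fact

section \<open>Exit times\<close>

lemma ereal_eq_by_real_lower_bounds:
  fixes a b :: ereal
  assumes "0 \<le> a" "0 \<le> b" and "\<And>c. 0 \<le> c \<Longrightarrow> ereal c \<le> a \<longleftrightarrow> ereal c \<le> b"
  shows "a = b"
proof (rule antisym)
  have le: "a \<le> b" if nn: "0 \<le> a" "0 \<le> b" and lower: "\<And>c. 0 \<le> c \<Longrightarrow> ereal c \<le> a \<Longrightarrow> ereal c \<le> b"
    for a b :: ereal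
  proof (rule ccontr)
    assume "\<not> a \<le> b"
    then have "b < a" by simp
    then obtain c where c: "b < ereal c" "ereal c < a"
      using ereal_dense2 by blast
    have "0 \<le> c"
      using le_less_trans[OF nn(2) c(1)] by simp
    with lower[of c] c show False by (simp add: less_imp_le leD)
  qed
  show "a \<le> b" by (rule le) (simp_all add: assms(1,2) assms(3)[symmetric] del: ereal_less_eq)
  show "b \<le> a" by (rule le) (simp_all add: assms(1,2) assms(3) del: ereal_less_eq)
qed

context flow_in_open_set
begin

abbreviation "tp \<equiv> tau_plus \<Phi> \<Omega>"
abbreviation "tm \<equiv> tau_minus \<Phi> \<Omega>"

text \<open>Reversing time exchanges \<open>tau_plus\<close> with \<open>tau_minus\<close> and entering with leaving, so every
  statement about \<open>tau_plus\<close> below has its mirror image for free.\<close>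

lemma reversed: "flow_in_open_set (\<lambda>x t. \<Phi> x (- t)) \<Omega>"
proof
  have "continuous_on UNIV (\<lambda>p. \<Phi> (fst (fst p, - snd p)) (snd (fst p, - snd p :: real)))"
    by (rule continuous_on_compose2[OF continuous_flow, of _ "\<lambda>p. (fst p, - snd p)"])
      (auto intro!: continuous_intros)
  then show "continuous_on UNIV (\<lambda>p. \<Phi> (fst p) (- snd p))" by simp
qed (auto simp: flow_flow open_domain)

lemma tau_plus_reversed: "tau_plus (\<lambda>x t. \<Phi> x (- t)) \<Omega> = tm"
  and tau_minus_reversed: "tau_minus (\<lambda>x t. \<Phi> x (- t)) \<Omega> = tp"
  by (auto simp: tau_plus_def tau_minus_def fun_eq_iff)

lemma continuous_on_flow [continuous_intros]:
  "continuous_on A f \<Longrightarrow> continuous_on A g \<Longrightarrow> continuous_on A (\<lambda>z. \<Phi> (f z) (g z))"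
  using continuous_on_compose2[OF continuous_flow, of A "\<lambda>z. (f z, g z)"]
  by (auto intro!: continuous_intros)

lemma borel_measurable_flow [measurable (raw)]:
  assumes "f \<in> borel_measurable N" "g \<in> borel_measurable N"
  shows "(\<lambda>z. \<Phi> (f z) (g z)) \<in> borel_measurable N"
proof -
  have "(\<lambda>p. \<Phi> (fst p) (snd p)) \<in> borel_measurable (borel \<Otimes>\<^sub>M borel)"
    using borel_measurable_continuous_onI[OF continuous_flow] by (simp add: borel_prod)
  from measurable_compose[OF measurable_Pair[OF assms] this] show ?thesis by simp
qed

lemma tau_plus_nonneg: "0 \<le> tp x"
  unfolding tau_plus_def by (rule Inf_greatest) auto

lemma le_tau_plus_iff: "ereal c \<le> tp x \<longleftrightarrow> (\<forall>s. 0 < s \<and> s < c \<longrightarrow> \<Phi> x s \<in> \<Omega>)"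
proof
  assume le: "ereal c \<le> tp x"
  show "\<forall>s. 0 < s \<and> s < c \<longrightarrow> \<Phi> x s \<in> \<Omega>"
  proof (intro allI impI, rule ccontr)
    fix s assume s: "0 < s \<and> s < c" and "\<Phi> x s \<notin> \<Omega>"
    then have "tp x \<le> ereal s"
      unfolding tau_plus_def by (intro Inf_lower) auto
    with le s show False
      by (metis ereal_less_eq(3) leD order_trans)
  qed
next
  assume "\<forall>s. 0 < s \<and> s < c \<longrightarrow> \<Phi> x s \<in> \<Omega>"
  then show "ereal c \<le> tp x"
    unfolding tau_plus_def by (intro Inf_greatest) (force simp: not_less)
qed

lemma less_tau_plusD: "0 < s \<Longrightarrow> ereal s < tp x \<Longrightarrow> \<Phi> x s \<in> \<Omega>"
  using Inf_lower[of "ereal s" "{ereal s |s. s > 0 \<and> \<Phi> x s \<notin> \<Omega>}"]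
  by (auto simp: tau_plus_def[symmetric] not_less[symmetric])

text \<open>Since \<open>\<Omega>\<close> is open, a curve that is inside up to and including time \<open>c\<close>
  stays inside a little longer.\<close>

lemma less_tau_plus_iff:
  assumes "x \<in> \<Omega>" "0 \<le> c"
  shows "ereal c < tp x \<longleftrightarrow> (\<forall>s\<in>{0..c}. \<Phi> x s \<in> \<Omega>)"
proof
  assume l: "ereal c < tp x"
  show "\<forall>s\<in>{0..c}. \<Phi> x s \<in> \<Omega>"
  proof
    fix s assume s: "s \<in> {0..c}"
    then have "ereal s < tp x" using l by (auto intro: le_less_trans[of _ "ereal c"])
    then show "\<Phi> x s \<in> \<Omega>"
      using less_tau_plusD[of s x] assms s by (cases "s = 0") auto
  qed
next
  assume *: "\<forall>s\<in>{0..c}. \<Phi> x s \<in> \<Omega>"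
  have "open ((\<lambda>s. \<Phi> x s) -` \<Omega>)"
    by (intro open_vimage open_domain continuous_intros)
  moreover have "c \<in> (\<lambda>s. \<Phi> x s) -` \<Omega>"
    using * assms by auto
  ultimately obtain e where e: "0 < e" "ball c e \<subseteq> (\<lambda>s. \<Phi> x s) -` \<Omega>"
    by (meson open_contains_ball)
  have "\<Phi> x s \<in> \<Omega>" if "0 < s" "s < c + e" for s
  proof (cases "s \<le> c")
    case False
    then have "s \<in> ball c e" using that by (auto simp: dist_real_def)
    then show ?thesis using e by auto
  qed (use * that in auto)
  then have "ereal (c + e) \<le> tp x"
    unfolding le_tau_plus_iff by blast
  moreover have "ereal c < ereal (c + e)" using e by simp
  ultimately show "ereal c < tp x" by (rule less_le_trans[rotated])
qed

lemma tau_plus_pos: "x \<in> \<Omega> \<Longrightarrow> 0 < tp x"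
  using less_tau_plus_iff[of x 0] by (auto simp: zero_ereal_def)

lemma flow_tau_plus_notin:
  assumes "x \<in> \<Omega>" "tp x = ereal r"
  shows "\<Phi> x r \<notin> \<Omega>"
proof
  have r: "0 < r" using tau_plus_pos[OF assms(1)] assms(2) by simp
  assume "\<Phi> x r \<in> \<Omega>"
  then have "\<Phi> x s \<in> \<Omega>" if "s \<in> {0..r}" for s
    using le_tau_plus_iff[of r x] assms that by (cases "s = 0"; cases "s = r") auto
  then have "ereal r < tp x" using less_tau_plus_iff[of x r] assms r by auto
  then show False using assms by simp
qed

lemma tau_plus_flow:
  assumes "0 \<le> r" "ereal r < tp x"
  shows "ereal r + tp (\<Phi> x r) = tp x"
proof (rule ereal_eq_by_real_lower_bounds)
  fix c :: real assume c: "0 \<le> c"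
  have *: "\<Phi> x s \<in> \<Omega>" if "0 < s" "s \<le> r" for s
    using that assms less_tau_plusD[of s x] le_less_trans[of "ereal s" "ereal r" "tp x"] by auto
  have "ereal c \<le> ereal r + tp (\<Phi> x r) \<longleftrightarrow> ereal (c - r) \<le> tp (\<Phi> x r)"
    by (cases "tp (\<Phi> x r)") auto
  also have "\<dots> \<longleftrightarrow> (\<forall>s. 0 < s \<and> s < c - r \<longrightarrow> \<Phi> x (r + s) \<in> \<Omega>)"
    by (simp add: le_tau_plus_iff flow_flow)
  also have "\<dots> \<longleftrightarrow> (\<forall>s. r < s \<and> s < c \<longrightarrow> \<Phi> x s \<in> \<Omega>)"
    (is "?A \<longleftrightarrow> ?B")
  proof
    assume ?A
    show ?B
    proof (intro allI impI)
      fix s assume "r < s \<and> s < c"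
      with \<open>?A\<close>[rule_format, of "s - r"] show "\<Phi> x s \<in> \<Omega>" by simp
    qed
  next
    assume ?B
    show ?A
    proof (intro allI impI)
      fix s assume "0 < s \<and> s < c - r"
      with \<open>?B\<close>[rule_format, of "r + s"] show "\<Phi> x (r + s) \<in> \<Omega>" by simp
    qed
  qed
  also have "\<dots> \<longleftrightarrow> (\<forall>s. 0 < s \<and> s < c \<longrightarrow> \<Phi> x s \<in> \<Omega>)"
  proof (intro iff_allI)
    fix s show "(r < s \<and> s < c \<longrightarrow> \<Phi> x s \<in> \<Omega>) \<longleftrightarrow> (0 < s \<and> s < c \<longrightarrow> \<Phi> x s \<in> \<Omega>)"
      using *[of s] assms(1) by (cases "s \<le> r") auto
  qed
  also have "\<dots> \<longleftrightarrow> ereal c \<le> tp x"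
    by (simp add: le_tau_plus_iff)
  finally show "ereal c \<le> ereal r + tp (\<Phi> x r) \<longleftrightarrow> ereal c \<le> tp x" .
next
  show "0 \<le> ereal r + tp (\<Phi> x r)"
    by (rule add_nonneg_nonneg[OF _ tau_plus_nonneg]) (use assms(1) in simp)
qed (rule tau_plus_nonneg)

text \<open>At \<open>s = 0\<close> the hypothesis says that \<open>x\<close> itself is inside. If only
  \<open>x\<close> is outside, the exit time of \<open>\<Phi> x (- r)\<close> is \<open>r\<close>, even when the curve re-enters \<open>\<Omega>\<close> at once;
  that is the subject of \<open>tau_plus_flow_backward_exit\<close>.\<close>

lemma tau_plus_flow_backward:
  assumes "0 < r" "\<And>s. 0 \<le> s \<Longrightarrow> s < r \<Longrightarrow> \<Phi> x (- s) \<in> \<Omega>"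
  shows "tp (\<Phi> x (- r)) = ereal r + tp x"
proof (rule ereal_eq_by_real_lower_bounds)
  fix c :: real assume c: "0 \<le> c"
  have *: "\<Phi> x (s - r) \<in> \<Omega>" if "0 < s" "s \<le> r" for s
    using that assms(2)[of "r - s"] by auto
  have "ereal c \<le> tp (\<Phi> x (- r)) \<longleftrightarrow> (\<forall>s. 0 < s \<and> s < c \<longrightarrow> \<Phi> x (s - r) \<in> \<Omega>)"
    by (simp add: le_tau_plus_iff flow_flow)
  also have "\<dots> \<longleftrightarrow> (\<forall>s. r < s \<and> s < c \<longrightarrow> \<Phi> x (s - r) \<in> \<Omega>)"
  proof (intro iff_allI)
    fix s
    show "(0 < s \<and> s < c \<longrightarrow> \<Phi> x (s - r) \<in> \<Omega>) \<longleftrightarrow> (r < s \<and> s < c \<longrightarrow> \<Phi> x (s - r) \<in> \<Omega>)"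
      using *[of s] assms(1) by (cases "s \<le> r") auto
  qed
  also have "\<dots> \<longleftrightarrow> (\<forall>s. 0 < s \<and> s < c - r \<longrightarrow> \<Phi> x s \<in> \<Omega>)"
    (is "?A \<longleftrightarrow> ?B")
  proof
    assume ?A
    show ?B
    proof (intro allI impI)
      fix s assume "0 < s \<and> s < c - r"
      with \<open>?A\<close>[rule_format, of "r + s"] show "\<Phi> x s \<in> \<Omega>" by simp
    qed
  next
    assume ?B
    show ?A
    proof (intro allI impI)
      fix s assume "r < s \<and> s < c"
      with \<open>?B\<close>[rule_format, of "s - r"] show "\<Phi> x (s - r) \<in> \<Omega>" by simp
    qed
  qed
  also have "\<dots> \<longleftrightarrow> ereal (c - r) \<le> tp x"
    by (simp add: le_tau_plus_iff)
  also have "\<dots> \<longleftrightarrow> ereal c \<le> ereal r + tp x"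
    by (cases "tp x") auto
  finally show "ereal c \<le> tp (\<Phi> x (- r)) \<longleftrightarrow> ereal c \<le> ereal r + tp x" .
next
  show "0 \<le> ereal r + tp x"
    by (rule add_nonneg_nonneg[OF _ tau_plus_nonneg]) (use assms(1) in simp)
qed (rule tau_plus_nonneg)

lemma tau_plus_flow_backward_exit:
  assumes "0 < r" "y \<notin> \<Omega>" "\<And>s. 0 < s \<Longrightarrow> s < r \<Longrightarrow> \<Phi> y (- s) \<in> \<Omega>"
  shows "tp (\<Phi> y (- r)) = ereal r"
proof (rule antisym)
  show "tp (\<Phi> y (- r)) \<le> ereal r"
    unfolding tau_plus_def using assms(1,2) by (intro Inf_lower) (auto simp: flow_flow)
  show "ereal r \<le> tp (\<Phi> y (- r))"
    unfolding le_tau_plus_iff using assms(3)[of "r - s" for s] by (auto simp: flow_flow)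
qed

text \<open>The set consists of the points whose curve over the compact interval \<open>{0..c}\<close> stays in the
  open set \<open>\<Omega>\<close>, so the tube lemma applies. This lower semicontinuity makes exit times Borel.\<close>

lemma open_less_tau_plus: "0 \<le> c \<Longrightarrow> open {x \<in> \<Omega>. ereal c < tp x}"
proof (subst open_subopen, intro ballI)
  fix x assume c: "0 \<le> c" and x: "x \<in> {x \<in> \<Omega>. ereal c < tp x}"
  have W: "open ((\<lambda>p. \<Phi> (fst p) (snd p)) -` \<Omega>)"
    by (intro open_vimage open_domain continuous_intros)
  have "{x} \<times> {0..c} \<subseteq> (\<lambda>p. \<Phi> (fst p) (snd p)) -` \<Omega>"
    using x less_tau_plus_iff[of x c] c by auto
  from Elementary_Topology.tube_lemma[OF compact_Icc W this] obtain U where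
    U: "x \<in> U" "open U" "U \<times> {0..c} \<subseteq> (\<lambda>p. \<Phi> (fst p) (snd p)) -` \<Omega>" by blast
  have "y \<in> \<Omega> \<and> ereal c < tp y" if "y \<in> U" for y
  proof -
    have *: "\<forall>s\<in>{0..c}. \<Phi> y s \<in> \<Omega>"
    proof
      fix s assume "s \<in> {0..c}"
      with that have "(y, s) \<in> U \<times> {0..c}" by blast
      with U(3) have "(y, s) \<in> (\<lambda>p. \<Phi> (fst p) (snd p)) -` \<Omega>" by (rule subsetD)
      then show "\<Phi> y s \<in> \<Omega>" by simp
    qed
    from bspec[OF *, of 0] c have "y \<in> \<Omega>" by simp
    then show ?thesis using * less_tau_plus_iff[of y c] c by blast
  qed
  then show "\<exists>T. open T \<and> x \<in> T \<and> T \<subseteq> {x \<in> \<Omega>. ereal c < tp x}"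
    using U by (intro exI[of _ U] conjI subsetI CollectI) simp_all
qed

lemma borel_measurable_tau_plus [measurable]: "tp \<in> borel_measurable (restrict_space borel \<Omega>)"
proof (rule borel_measurableI_greater)
  fix y :: ereal
  have "{x \<in> \<Omega>. y < tp x} \<in> sets borel"
  proof (cases "0 \<le> y")
    case True
    show ?thesis
    proof (cases y)
      case (real c)
      then show ?thesis using open_less_tau_plus[of c] True by auto
    qed (use True in auto)
  next
    case False
    then have "{x \<in> \<Omega>. y < tp x} = \<Omega>"
      using less_le_trans[OF _ tau_plus_nonneg, of y] by auto
    then show ?thesis using open_domain by auto
  qed
  then show "{x \<in> space (restrict_space borel \<Omega>). y < tp x} \<in> sets (restrict_space borel \<Omega>)"
    using open_domain by (subst sets_restrict_space_iff) (auto simp: space_restrict_space)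
qed

lemmas borel_measurable_tau_minus [measurable] =
  flow_in_open_set.borel_measurable_tau_plus[OF reversed, unfolded tau_plus_reversed]

lemmas tau_minus_nonneg = flow_in_open_set.tau_plus_nonneg[OF reversed, unfolded tau_plus_reversed]
lemmas tau_minus_pos = flow_in_open_set.tau_plus_pos[OF reversed, unfolded tau_plus_reversed]
lemmas less_tau_minusD = flow_in_open_set.less_tau_plusD[OF reversed, unfolded tau_plus_reversed]
lemmas flow_tau_minus_notin =
  flow_in_open_set.flow_tau_plus_notin[OF reversed, unfolded tau_plus_reversed]
lemmas tau_minus_flow = flow_in_open_set.tau_plus_flow[OF reversed, unfolded tau_plus_reversed]
lemmas tau_minus_flow_forward =
  flow_in_open_set.tau_plus_flow_backward[OF reversed, unfolded tau_plus_reversed minus_minus]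
lemmas tau_minus_flow_forward_entry =
  flow_in_open_set.tau_plus_flow_backward_exit[OF reversed, unfolded tau_plus_reversed minus_minus]

end

section \<open>Integration by parts along a curve\<close>

text \<open>Integration by parts against a primitive of a merely integrable function: Fubini on the
  triangle \<open>{(r, s). 0 \<le> r \<and> r \<le> s \<and> s \<le> L}\<close>.\<close>

lemma integral_indefinite_integral_by_parts:
  fixes G \<phi> \<phi>' :: "real \<Rightarrow> real"
  assumes L: "0 \<le> L" and G: "G absolutely_integrable_on {0..L}"
    and der: "\<And>s. (\<phi> has_real_derivative \<phi>' s) (at s)" and cont: "continuous_on UNIV \<phi>'"
  shows "integral {0..L} (\<lambda>s. integral {0..s} G * \<phi>' s)
    = integral {0..L} G * \<phi> L - integral {0..L} (\<lambda>s. G s * \<phi> s)"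
proof -
  have cont\<phi>: "continuous_on A \<phi>" for A
    using der DERIV_isCont continuous_at_imp_continuous_on by blast
  have [measurable]: "\<phi>' \<in> borel_measurable borel" "\<phi> \<in> borel_measurable borel"
    using cont cont\<phi> by (auto intro: borel_measurable_continuous_onI)
  have "(\<lambda>s. indicator {0..L} s *\<^sub>R G s) \<in> borel_measurable (completion lborel)"
    using G borel_measurable_integrable unfolding set_integrable_def by blast
  from completion_ex_borel_measurable_real[OF this] obtain G' where
    G'[measurable]: "G' \<in> borel_measurable lborel"
    and eq: "AE s in lborel. indicator {0..L} s *\<^sub>R G s = G' s" by blast
  define G2 where "G2 s = indicator {0..L} s * G' s" for s
  have [measurable]: "G2 \<in> borel_measurable borel"
    unfolding G2_def using G' by simp
  have eq2: "AE s in lebesgue. indicator {0..L} s *\<^sub>R G s = G2 s"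
    using AE_completion[OF eq] by eventually_elim (auto simp: G2_def indicator_def of_bool_def split: if_splits)
  have int2: "integrable lborel G2"
  proof -
    have "integrable lebesgue G2"
    proof (rule iffD1[OF integrable_cong_AE[OF _ _ eq2]])
      show "integrable lebesgue (\<lambda>s. indicator {0..L} s *\<^sub>R G s)"
        using G unfolding set_integrable_def .
      then show "(\<lambda>s. indicator {0..L} s *\<^sub>R G s) \<in> borel_measurable lebesgue"
        by (rule borel_measurable_integrable)
    qed (auto intro!: measurable_completion)
    then show ?thesis by (subst (asm) integrable_completion) auto
  qed
  \<comment> \<open>transfer of integrals of \<open>G\<close> against a Borel weight to \<open>G2\<close>\<close>
  have transfer: "(LINT r:S|lebesgue. G r * k r) = (\<integral>r. G2 r * (k r * indicator S r) \<partial>lborel)"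
    if [measurable]: "S \<in> sets borel" "k \<in> borel_measurable borel" and S: "S \<subseteq> {0..L}" for S k
  proof -
    have "(LINT r:S|lebesgue. G r * k r) = (\<integral>r. G2 r * (k r * indicator S r) \<partial>lebesgue)"
      unfolding set_lebesgue_integral_def
    proof (rule integral_cong_AE)
      have "(\<lambda>r. (indicator {0..L} r *\<^sub>R G r) * (k r * indicator S r)) \<in> borel_measurable lebesgue"
        using G unfolding set_integrable_def
        by (intro borel_measurable_times borel_measurable_integrable[of lebesgue "\<lambda>r. indicator {0..L} r *\<^sub>R G r"]
            measurable_completion) auto
      also have "(\<lambda>r. (indicator {0..L} r *\<^sub>R G r) * (k r * indicator S r)) = (\<lambda>r. indicator S r *\<^sub>R (G r * k r))"
        using S by (auto simp: fun_eq_iff indicator_def)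
      finally show "(\<lambda>r. indicator S r *\<^sub>R (G r * k r)) \<in> borel_measurable lebesgue" .
      show "AE r in lebesgue. indicator S r *\<^sub>R (G r * k r) = G2 r * (k r * indicator S r)"
        using eq2 by eventually_elim (use S in \<open>auto simp: indicator_def split: if_splits\<close>)
    qed (auto intro!: measurable_completion)
    also have "\<dots> = (\<integral>r. G2 r * (k r * indicator S r) \<partial>lborel)"
      by (rule integral_completion) auto
    finally show ?thesis .
  qed
  define K where "K s = (\<integral>r. G2 r * indicator {..s} r \<partial>lborel)" for s
  have K: "integral {0..s} G = K s" if "s \<in> {0..L}" for s
  proof -
    have "G absolutely_integrable_on {0..s}"
      using absolutely_integrable_on_subinterval[OF G] that by auto
    then have "integral {0..s} G = (LINT r:{0..s}|lebesgue. G r)"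
      by (rule set_lebesgue_integral_eq_integral(2)[symmetric])
    also have "\<dots> = (\<integral>r. G2 r * (1 * indicator {0..s} r) \<partial>lborel)"
      using transfer[of "{0..s}" "\<lambda>_. 1"] that by auto
    also have "\<dots> = K s"
      unfolding K_def by (intro Bochner_Integration.integral_cong) (auto simp: G2_def indicator_def)
    finally show ?thesis .
  qed
  have triangle: "integrable (lborel \<Otimes>\<^sub>M lborel)
      (\<lambda>(r, s). G2 r * (\<phi>' s * indicator {0..L} s) * indicator {..s} r)"
    (is "integrable _ (\<lambda>(r, s). ?H r s)")
  proof -
    have int\<phi>: "integrable lborel (\<lambda>s. \<phi>' s * indicator {0..L} s)"
      by (rule borel_integrable_atLeastAtMost) (use cont in \<open>auto simp: continuous_on_eq_continuous_at\<close>)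
    have prod: "integrable (lborel \<Otimes>\<^sub>M lborel) (\<lambda>(r, s). G2 r * (\<phi>' s * indicator {0..L} s))"
    proof (rule lborel_pair.Fubini_integrable)
      show "integrable lborel (\<lambda>r. \<integral>s. norm (case (r, s) of (r, s) \<Rightarrow> G2 r * (\<phi>' s * indicator {0..L} s)) \<partial>lborel)"
        using int2 by (simp add: abs_mult)
      show "AE r in lborel. integrable lborel (\<lambda>s. case (r, s) of (r, s) \<Rightarrow> G2 r * (\<phi>' s * indicator {0..L} s))"
        using int\<phi> by simp
    qed measurable
    have [measurable]: "{p. fst p \<le> (snd p :: real)} \<in> sets (lborel \<Otimes>\<^sub>M lborel)"
    proof -
      have "{p \<in> space (lborel \<Otimes>\<^sub>M lborel). fst p \<le> (snd p :: real)} \<in> sets (lborel \<Otimes>\<^sub>M lborel)"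
        by measurable
      then show ?thesis by (simp add: space_pair_measure)
    qed
    have "integrable (lborel \<Otimes>\<^sub>M lborel)
        (\<lambda>p. indicator {p. fst p \<le> snd p} p *\<^sub>R (case p of (r, s) \<Rightarrow> G2 r * (\<phi>' s * indicator {0..L} s)))"
      by (rule integrable_mult_indicator[OF _ prod]) measurable
    also have "(\<lambda>p. indicator {p. fst p \<le> snd p} p *\<^sub>R (case p of (r, s) \<Rightarrow> G2 r * (\<phi>' s * indicator {0..L} s)))
        = (\<lambda>(r, s). ?H r s)"
      by (auto simp: fun_eq_iff indicator_def)
    finally show ?thesis .
  qed
  have "integral {0..L} (\<lambda>s. integral {0..s} G * \<phi>' s) = (LINT s:{0..L}|lebesgue. integral {0..s} G * \<phi>' s)"
  proof (rule set_lebesgue_integral_eq_integral(2)[symmetric])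
    show "(\<lambda>s. integral {0..s} G * \<phi>' s) absolutely_integrable_on {0..L}"
      using G absolutely_integrable_on_def
      by (intro absolutely_integrable_continuous_real continuous_intros
          indefinite_integral_continuous_1 continuous_on_subset[OF cont]) auto
  qed
  also have "\<dots> = (\<integral>s. K s * (\<phi>' s * indicator {0..L} s) \<partial>lebesgue)"
    unfolding set_lebesgue_integral_def
    by (intro Bochner_Integration.integral_cong) (auto simp: K indicator_def)
  also have "\<dots> = (\<integral>s. K s * (\<phi>' s * indicator {0..L} s) \<partial>lborel)"
  proof (rule integral_completion)
    have [measurable]: "K \<in> borel_measurable borel"
    proof -
      have "(\<lambda>(s, r). G2 r * indicator {..s} r) \<in> borel_measurable (borel \<Otimes>\<^sub>M lborel)"
        by (simp add: indicator_def[abs_def] case_prod_unfold)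
      from lborel.borel_measurable_lebesgue_integral[OF this]
      show ?thesis unfolding K_def by simp
    qed
    show "(\<lambda>s. K s * (\<phi>' s * indicator {0..L} s)) \<in> borel_measurable lborel"
      by measurable
  qed
  also have "\<dots> = (\<integral>s. (\<integral>r. ?H r s \<partial>lborel) \<partial>lborel)"
  proof (intro Bochner_Integration.integral_cong refl)
    fix s
    have "?H r s = (G2 r * indicator {..s} r) * (\<phi>' s * indicator {0..L} s)" for r
      by (simp add: mult_ac)
    then show "K s * (\<phi>' s * indicator {0..L} s) = (\<integral>r. ?H r s \<partial>lborel)"
      by (simp only: integral_mult_left_zero K_def)
  qed
  also have "\<dots> = (\<integral>r. (\<integral>s. ?H r s \<partial>lborel) \<partial>lborel)"
    by (rule lborel_pair.Fubini_integral[OF triangle])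
  also have "\<dots> = (\<integral>r. G2 r * (\<phi> L * indicator {0..L} r) - G2 r * (\<phi> r * indicator {0..L} r) \<partial>lborel)"
  proof (intro Bochner_Integration.integral_cong refl)
    fix r
    show "(\<integral>s. ?H r s \<partial>lborel) = G2 r * (\<phi> L * indicator {0..L} r) - G2 r * (\<phi> r * indicator {0..L} r)"
    proof (cases "r \<in> {0..L}")
      case True
      have "(\<integral>s. ?H r s \<partial>lborel) = (\<integral>s. G2 r * (\<phi>' s * indicator {r..L} s) \<partial>lborel)"
        using True by (intro Bochner_Integration.integral_cong) (auto simp: indicator_def)
      also have "\<dots> = G2 r * (\<phi> L - \<phi> r)"
        using True der cont
        by (subst integral_mult_right_zero, subst integral_FTC_Icc_real[where F = \<phi>])
          (auto simp: continuous_on_eq_continuous_at)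
      finally show ?thesis using True by (simp add: algebra_simps)
    qed (simp add: G2_def)
  qed
  also have "\<dots> = (\<integral>r. G2 r * (\<phi> L * indicator {0..L} r) \<partial>lborel) - (\<integral>r. G2 r * (\<phi> r * indicator {0..L} r) \<partial>lborel)"
  proof (rule Bochner_Integration.integral_diff)
    have weighted: "integrable lborel (\<lambda>r. G2 r * (k r * indicator {0..L} r))" if k: "continuous_on {0..L} k"
      "k \<in> borel_measurable borel" for k
    proof -
      obtain B where B: "\<And>r. r \<in> {0..L} \<Longrightarrow> \<bar>k r\<bar> \<le> B"
        using compact_imp_bounded[OF compact_continuous_image[OF k(1) compact_Icc]]
        by (force simp: bounded_iff)
      show ?thesis
      proof (rule Bochner_Integration.integrable_bound[of _ "\<lambda>r. B * G2 r"])
        show "AE r in lborel. norm (G2 r * (k r * indicator {0..L} r)) \<le> norm (B * G2 r)"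
        proof (intro AE_I2)
          fix r
          show "norm (G2 r * (k r * indicator {0..L} r)) \<le> norm (B * G2 r)"
          proof (cases "r \<in> {0..L}")
            case True
            have "\<bar>k r\<bar> \<le> \<bar>B\<bar>" using B[OF True] by simp
            then have "\<bar>k r\<bar> * \<bar>G2 r\<bar> \<le> \<bar>B\<bar> * \<bar>G2 r\<bar>" by (rule mult_right_mono) simp
            then show ?thesis using True by (simp add: abs_mult mult.commute)
          qed simp
        qed
      qed (use int2 k(2) in auto)
    qed
    from weighted[of "\<lambda>_. \<phi> L"] weighted[of \<phi>] cont\<phi>
    show "integrable lborel (\<lambda>r. G2 r * (\<phi> L * indicator {0..L} r))"
      and "integrable lborel (\<lambda>r. G2 r * (\<phi> r * indicator {0..L} r))" by auto
  qed
  also have "(\<integral>r. G2 r * (\<phi> L * indicator {0..L} r) \<partial>lborel) = (LINT r:{0..L}|lebesgue. G r * \<phi> L)"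
    by (rule transfer[of "{0..L}" "\<lambda>_. \<phi> L", symmetric]) auto
  also have "\<dots> = integral {0..L} G * \<phi> L"
    using set_lebesgue_integral_eq_integral(2)[OF G] by simp
  also have "(\<integral>r. G2 r * (\<phi> r * indicator {0..L} r) \<partial>lborel) = (LINT r:{0..L}|lebesgue. G r * \<phi> r)"
    by (rule transfer[of "{0..L}" \<phi>, symmetric]) auto
  also have "\<dots> = integral {0..L} (\<lambda>s. G s * \<phi> s)"
  proof (rule set_lebesgue_integral_eq_integral(2))
    have "(\<lambda>s. \<phi> s * G s) absolutely_integrable_on {0..L}"
      by (rule absolutely_integrable_bounded_measurable_product_real[OF _ _ _ G])
        (auto intro!: compact_imp_bounded compact_continuous_image cont\<phi>
          continuous_imp_measurable_on_sets_lebesgue)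
    then show "(\<lambda>s. G s * \<phi> s) absolutely_integrable_on {0..L}" by (simp add: mult.commute)
  qed
  finally show ?thesis .
qed

text \<open>Here \<open>p\<close> is a primitive of \<open>G\<close>, so it extends continuously to the closed interval, and
  \<open>q * \<phi>' + G * \<phi>\<close> is almost everywhere the derivative of \<open>p * \<phi>\<close>. The function \<open>q\<close> differs
  from \<open>p\<close> on a null set only; it stands for a representative for which pointwise
  identities along the curve are not available.\<close>

lemma integral_product_rule_open_interval:
  fixes G p q \<phi> \<phi>' :: "real \<Rightarrow> real"
  assumes L: "0 < L" and G: "set_integrable lebesgue {0<..<L} G"
    and p: "\<And>s1 s2. 0 < s2 \<Longrightarrow> s2 \<le> s1 \<Longrightarrow> s1 < L \<Longrightarrow> p s1 - p s2 = (LINT s:{s2..s1}|lebesgue. G s)"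
    and q: "AE s in lebesgue. 0 < s \<and> s < L \<longrightarrow> q s = p s"
    and der: "\<And>s. (\<phi> has_real_derivative \<phi>' s) (at s)" and cont: "continuous_on UNIV \<phi>'"
  obtains A B where "(p \<longlongrightarrow> A) (at_right 0)" "(p \<longlongrightarrow> B) (at_left L)"
    "has_bochner_integral lebesgue (\<lambda>s. indicator {0<..<L} s *\<^sub>R (q s * \<phi>' s + G s * \<phi> s)) (B * \<phi> L - A * \<phi> 0)"
proof -
  have G': "G absolutely_integrable_on {0..L}"
    using G absolutely_integrable_on_open_interval[where f = G and a = 0 and b = L] by (simp add: box_real cbox_interval)
  then have Gint: "G integrable_on {0..L}" by (simp add: absolutely_integrable_on_def)
  have cont\<phi>: "continuous_on A \<phi>" for A
    using der DERIV_isCont continuous_at_imp_continuous_on by blast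
  define K where "K s = integral {0..s} G" for s
  define A where "A = p (L / 2) - K (L / 2)"
  have diff: "p s1 - p s2 = K s1 - K s2" if "0 < s2" "s2 \<le> s1" "s1 < L" for s1 s2
  proof -
    have "p s1 - p s2 = (LINT s:{s2..s1}|lebesgue. G s)" by (rule p[OF that])
    also have "\<dots> = integral {s2..s1} G"
      using that by (intro set_lebesgue_integral_eq_integral(2) absolutely_integrable_on_subinterval[OF G']) auto
    also have "\<dots> = K s1 - K s2"
      unfolding K_def
      using Henstock_Kurzweil_Integration.integral_combine[of 0 s2 s1 G] that
        integrable_on_subinterval[OF Gint, of 0 s1] by auto
    finally show ?thesis .
  qed
  have pK: "p s = A + K s" if "0 < s" "s < L" for s
    using diff[of s "L / 2"] diff[of "L / 2" s] that L unfolding A_def by (cases "s \<le> L / 2") auto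
  have contK: "continuous_on {0..L} K"
    unfolding K_def by (rule indefinite_integral_continuous_1[OF Gint])
  have K0: "K 0 = 0" by (simp add: K_def)
  have "(K \<longlongrightarrow> K 0) (at 0 within {0..L})" "(K \<longlongrightarrow> K L) (at L within {0..L})"
    using contK L by (auto simp: continuous_on_def)
  then have lim: "(K \<longlongrightarrow> 0) (at_right 0)" "(K \<longlongrightarrow> K L) (at_left L)"
    using L by (simp_all add: K0 at_within_Icc_at_right at_within_Icc_at_left)
  have "((\<lambda>s. A + K s) \<longlongrightarrow> A + 0) (at_right 0)"
    by (intro tendsto_intros lim)
  then have l1: "(p \<longlongrightarrow> A) (at_right 0)"
    unfolding add_0_right
    by (rule iffD1[OF tendsto_cong, rotated])
      (use L pK in \<open>auto simp: eventually_at_right_field intro!: exI[of _ L]\<close>)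
  have "((\<lambda>s. A + K s) \<longlongrightarrow> A + K L) (at_left L)"
    by (intro tendsto_intros lim)
  then have l2: "(p \<longlongrightarrow> A + K L) (at_left L)"
    by (rule iffD1[OF tendsto_cong, rotated])
      (use L pK in \<open>auto simp: eventually_at_left_field intro!: exI[of _ 0]\<close>)
  have abs1: "(\<lambda>s. (A + K s) * \<phi>' s) absolutely_integrable_on {0..L}"
    by (intro absolutely_integrable_continuous_real continuous_intros contK continuous_on_subset[OF cont]) auto
  have "(\<lambda>s. \<phi> s * G s) absolutely_integrable_on {0..L}"
    by (rule absolutely_integrable_bounded_measurable_product_real[OF _ _ _ G'])
      (auto intro!: compact_imp_bounded compact_continuous_image cont\<phi>
        continuous_imp_measurable_on_sets_lebesgue)
  then have abs2: "(\<lambda>s. G s * \<phi> s) absolutely_integrable_on {0..L}" by (simp add: mult.commute)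
  define R where "R s = (A + K s) * \<phi>' s + G s * \<phi> s" for s
  have abs: "R absolutely_integrable_on {0..L}"
    unfolding R_def by (rule set_integral_add(1)[OF abs1 abs2])
  have "integral {0..L} R = integral {0..L} (\<lambda>s. (A + K s) * \<phi>' s) + integral {0..L} (\<lambda>s. G s * \<phi> s)"
    unfolding R_def using abs1 abs2
    by (intro Henstock_Kurzweil_Integration.integral_add) (auto simp: absolutely_integrable_on_def)
  also have "integral {0..L} (\<lambda>s. (A + K s) * \<phi>' s)
      = integral {0..L} (\<lambda>s. A * \<phi>' s) + integral {0..L} (\<lambda>s. K s * \<phi>' s)"
    unfolding distrib_right
    by (intro Henstock_Kurzweil_Integration.integral_add integrable_continuous_real continuous_intros contK
        continuous_on_subset[OF cont]) auto
  also have "integral {0..L} (\<lambda>s. A * \<phi>' s) = A * (\<phi> L - \<phi> 0)"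
  proof -
    have "(\<phi>' has_integral (\<phi> L - \<phi> 0)) {0..L}"
      using L der
      by (intro fundamental_theorem_of_calculus)
        (auto simp: has_real_derivative_iff_has_vector_derivative[symmetric] intro: has_field_derivative_at_within)
    then show ?thesis by (simp add: integral_unique)
  qed
  also have "integral {0..L} (\<lambda>s. K s * \<phi>' s) = K L * \<phi> L - integral {0..L} (\<lambda>s. G s * \<phi> s)"
    unfolding K_def using L by (intro integral_indefinite_integral_by_parts[OF _ G' der cont]) simp
  finally have val: "integral {0..L} R = (A + K L) * \<phi> L - A * \<phi> 0"
    by (simp add: algebra_simps)
  have absR: "R absolutely_integrable_on {0<..<L}"
    using abs absolutely_integrable_on_open_interval[where f = R and a = 0 and b = L] by (simp add: box_real cbox_interval)
  have "(LINT s:{0<..<L}|lebesgue. R s) = integral {0<..<L} R"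
    by (rule set_lebesgue_integral_eq_integral(2)[OF absR])
  also have "\<dots> = integral {0..L} R"
    using integral_open_interval[of 0 L R] by (simp add: box_real cbox_interval)
  finally have hbR: "has_bochner_integral lebesgue (\<lambda>s. indicator {0<..<L} s *\<^sub>R R s) ((A + K L) * \<phi> L - A * \<phi> 0)"
    using absR val by (simp add: has_bochner_integral_iff set_integrable_def set_lebesgue_integral_def)
  have ae: "AE s in lebesgue. indicator {0<..<L} s *\<^sub>R R s = indicator {0<..<L} s *\<^sub>R (q s * \<phi>' s + G s * \<phi> s)"
    using q by eventually_elim (auto simp: R_def pK indicator_def)
  have meas: "(\<lambda>s. indicator {0<..<L} s *\<^sub>R R s) \<in> borel_measurable lebesgue"
    using hbR by (auto simp: has_bochner_integral_iff)
  have "has_bochner_integral lebesgue (\<lambda>s. indicator {0<..<L} s *\<^sub>R (q s * \<phi>' s + G s * \<phi> s)) ((A + K L) * \<phi> L - A * \<phi> 0)"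
    using hbR has_bochner_integral_cong_AE[OF meas borel_measurable_AE[OF meas ae] ae] by simp
  from that[OF l1 l2 this] show thesis .
qed

section \<open>Transporting boundary data along curves\<close>

text \<open>The time cut-off \<open>\<chi>\<close> of the introduction.\<close>

definition bump :: "real \<Rightarrow> real" where
  "bump t = t * (1 - t)"

context flow_in_open_set
begin

definition entry :: "'a \<Rightarrow> 'a" where
  "entry x = \<Phi> x (- real_of_ereal (tm x))"

text \<open>The function \<open>u\<close> of the introduction. If \<open>tm x < t\<close>, the point \<open>x\<close> at time \<open>t\<close> lies on a curve that
  entered at time \<open>t - tm x\<close> and that leaves \<open>\<Omega> \<times> (0, 1)\<close> at time \<open>min (t + tp x) 1\<close>; the denominator is the
  difference of the two.\<close>

definition transported :: "('a \<Rightarrow> real) \<Rightarrow> 'a \<times> real \<Rightarrow> real" where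
  "transported b = (\<lambda>(x, t). if tm x < ereal t
     then b (entry x) * bump (t - real_of_ereal (tm x))
       / real_of_ereal (min (tm x + tp x) (ereal (1 - t) + tm x))
     else 0)"

lemma flow_cancel [simp]: "\<Phi> (\<Phi> x s) (- s) = x" "\<Phi> (\<Phi> x (- s)) s = x"
  by (simp_all add: flow_flow)

text \<open>The length in the definition of \<open>length_from\<close> is independent of the chosen curve point, because
  it is the exit time of the boundary point itself.\<close>

lemma Gamma_minus_props:
  assumes "y \<in> Gamma_minus \<Phi> \<Omega>"
  shows "y \<notin> \<Omega>" "0 < tp y" "length_from \<Phi> \<Omega> y = tp y"
proof -
  have *: "y \<notin> \<Omega> \<and> tp y = tm x + tp x"
    if x: "x \<in> \<Omega>" "tm x < \<infinity>" "y = \<Phi> x (- real_of_ereal (tm x))" for x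
  proof -
    obtain r where r: "tm x = ereal r" "0 < r"
      using x tau_minus_pos[OF x(1)] by (cases "tm x") auto
    have "\<Phi> x (- s) \<in> \<Omega>" if "0 \<le> s" "s < r" for s
      using that less_tau_minusD[of s x] r x(1) by (cases "s = 0") auto
    then have "tp y = ereal r + tp x"
      using x(3) r by (simp add: tau_plus_flow_backward)
    then show ?thesis using flow_tau_minus_notin[OF x(1) r(1)] x(3) r by simp
  qed
  obtain x where x: "x \<in> \<Omega>" "tm x < \<infinity>" "y = \<Phi> x (- real_of_ereal (tm x))"
    using assms by (auto simp: Gamma_minus_def)
  show "y \<notin> \<Omega>" using *[OF x] by blast
  show "0 < tp y"
    using *[OF x] tau_minus_nonneg[of x] tau_plus_pos[OF x(1)]
    by (metis add.commute add_nonneg_eq_0_iff less_le order_less_imp_le tau_plus_nonneg)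
  show "length_from \<Phi> \<Omega> y = tp y"
    unfolding length_from_def
  proof (rule the_equality)
    show "\<exists>x\<in>\<Omega>. tm x < \<infinity> \<and> y = \<Phi> x (- real_of_ereal (tm x)) \<and> tp y = tm x + tp x"
      using x *[OF x] by blast
    show "l = tp y" if "\<exists>x\<in>\<Omega>. tm x < \<infinity> \<and> y = \<Phi> x (- real_of_ereal (tm x)) \<and> l = tm x + tp x" for l
      using that * by metis
  qed
qed

lemma entry_in_Gamma_minus:
  assumes "x \<in> \<Omega>" "tm x < \<infinity>"
  shows "entry x \<in> Gamma_minus \<Phi> \<Omega>"
proof -
  obtain r where r: "tm x = ereal r" "0 < r"
    using assms tau_minus_pos[OF assms(1)] by (cases "tm x") auto
  have notin: "\<Phi> x (- r) \<notin> \<Omega>"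
    using flow_tau_minus_notin[OF assms(1) r(1)] .
  have "((\<lambda>s. \<Phi> x (- s)) \<longlongrightarrow> \<Phi> x (- r)) (at_left r)"
  proof -
    have "continuous_on UNIV (\<lambda>s. \<Phi> x (- s))" by (intro continuous_intros)
    then have "isCont (\<lambda>s. \<Phi> x (- s)) r" by (simp add: continuous_on_eq_continuous_at)
    then show ?thesis by (simp add: isCont_def filterlim_at_split)
  qed
  moreover have "\<forall>\<^sub>F s in at_left r. \<Phi> x (- s) \<in> closure \<Omega>"
    unfolding eventually_at_left_field
    using less_tau_minusD[of _ x] r by (intro exI[of _ 0]) (auto intro!: closure_subset[THEN subsetD])
  ultimately have "\<Phi> x (- r) \<in> closure \<Omega>"
    by (intro Lim_in_closed_set[where F = "at_left r" and f = "\<lambda>s. \<Phi> x (- s)"]) auto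
  with notin have "\<Phi> x (- r) \<in> frontier \<Omega>"
    using open_domain by (simp add: frontier_def interior_open)
  then show ?thesis using assms r by (auto simp: Gamma_minus_def entry_def intro!: bexI[of _ x])
qed

lemma Gamma_plus_props:
  assumes "y \<in> Gamma_plus \<Phi> \<Omega>"
  shows "y \<notin> \<Omega>" "0 < tm y" "length_to \<Phi> \<Omega> y = tm y"
proof -
  have "Gamma_minus (\<lambda>x t. \<Phi> x (- t)) \<Omega> = Gamma_plus \<Phi> \<Omega>"
    by (simp add: Gamma_minus_def Gamma_plus_def tau_minus_reversed)
  moreover have "length_from (\<lambda>x t. \<Phi> x (- t)) \<Omega> y = length_to \<Phi> \<Omega> y"
    by (simp add: length_from_def length_to_def tau_minus_reversed tau_plus_reversed add.commute)
  ultimately show "y \<notin> \<Omega>" "0 < tm y" "length_to \<Phi> \<Omega> y = tm y"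
    using flow_in_open_set.Gamma_minus_props[OF reversed, of y] assms
    by (simp_all add: tau_plus_reversed)
qed

lemma transported_from_entry:
  assumes "y \<notin> \<Omega>" "0 < s" "ereal s < min (tp y) (ereal (1 - t))" "0 < t"
  shows "transported b (\<Phi> y s, t + s) = b y * bump t / real_of_ereal (min (tp y) (ereal (1 - t)))"
proof -
  have 1: "tm (\<Phi> y s) = ereal s"
  proof (rule tau_minus_flow_forward_entry)
    fix s' assume s': "0 < s'" "s' < s"
    then have "ereal s' < tp y" using assms by (auto intro: less_trans[of _ "ereal s"])
    then show "\<Phi> y s' \<in> \<Omega>" using s' less_tau_plusD by blast
  qed (use assms in auto)
  have 2: "ereal s + tp (\<Phi> y s) = tp y"
    using assms by (intro tau_plus_flow) auto
  show ?thesis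
    using 1 2 assms by (simp add: transported_def entry_def algebra_simps)
qed

text \<open>At time \<open>s\<close> the curve has been inside \<open>\<Omega>\<close> for at least the time \<open>s\<close>, so it did not enter after
  time \<open>0\<close> and carries no boundary data.\<close>

lemma transported_from_initial_time:
  assumes "x \<in> \<Omega>" "0 < s" "ereal s < tp x"
  shows "transported b (\<Phi> x s, s) = 0"
proof -
  have "tm (\<Phi> x s) = ereal s + tm x"
  proof (rule tau_minus_flow_forward)
    fix s' assume s': "0 \<le> s'" "s' < s"
    then have "ereal s' < tp x" using assms by (auto intro: less_trans[of _ "ereal s"])
    then show "\<Phi> x s' \<in> \<Omega>" using s' less_tau_plusD assms(1) by (cases "s' = 0") auto
  qed (use assms in auto)
  then have "ereal s \<le> tm (\<Phi> x s)"
    using add_left_mono[OF tau_minus_nonneg[of x], of "ereal s"] by simp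
  then show ?thesis by (simp add: transported_def leD)
qed

text \<open>If \<open>z\<close> is outside \<open>\<Omega>\<close>, the curve leaves \<open>\<Omega>\<close> at \<open>z\<close> at time \<open>t\<close>; if \<open>t = 1\<close>, it leaves the time interval. In
  both cases its length since entry is \<open>tm z\<close>.\<close>

lemma transported_backward:
  assumes z: "z \<notin> \<Omega> \<or> t = 1" and t: "0 < t" "t \<le> 1" and s: "0 < s" "ereal s < min (tm z) (ereal t)"
  shows "transported b (\<Phi> z (- s), t - s) =
    (if tm z < ereal t then b (entry z) * bump (t - real_of_ereal (tm z)) / real_of_ereal (tm z) else 0)"
proof -
  have inside: "\<Phi> z (- s') \<in> \<Omega>" if "0 < s'" "s' \<le> s" for s'
  proof -
    have "ereal s' < tm z" using that s by (auto intro: le_less_trans[of _ "ereal s"])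
    then show ?thesis using that less_tau_minusD by blast
  qed
  define q where "q = \<Phi> z (- s)"
  have 1: "ereal s + tm q = tm z"
    unfolding q_def using s by (intro tau_minus_flow) auto
  have 2: "tp q = ereal s + (if z \<in> \<Omega> then tp z else 0)"
  proof (cases "z \<in> \<Omega>")
    case True
    have "\<Phi> z (- s') \<in> \<Omega>" if "0 \<le> s'" "s' < s" for s'
      using that inside[of s'] True by (cases "s' = 0") auto
    then show ?thesis using True s by (simp add: q_def tau_plus_flow_backward)
  next
    case False
    then show ?thesis using inside s by (simp add: q_def tau_plus_flow_backward_exit)
  qed
  show ?thesis
  proof (cases "tm z < ereal t")
    case True
    then obtain r where r: "tm z = ereal r" "r < t"
      using tau_minus_nonneg[of z] by (cases "tm z") auto
    then have q: "tm q = ereal (r - s)" using 1 by (cases "tm q") auto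
    have "min (tm q + tp q) (ereal (1 - (t - s)) + tm q) = ereal r"
    proof (cases "z \<in> \<Omega>")
      case True
      then have "t = 1" using z by simp
      then show ?thesis using True 2 q tau_plus_nonneg[of z] by (cases "tp z") (auto simp: min_def)
    next
      case False
      then show ?thesis using 2 q t by (auto simp: min_def)
    qed
    moreover have "entry q = entry z"
      using q r by (simp add: entry_def q_def flow_flow)
    ultimately show ?thesis
      using r q by (simp add: transported_def q_def[symmetric])
  next
    case False
    then have "\<not> tm q < ereal (t - s)"
      using 1[symmetric] tau_minus_nonneg[of q] by (cases "tm q") auto
    then show ?thesis using False by (simp add: transported_def q_def[symmetric])
  qed
qed

text \<open>The datum \<open>b\<close> is measurable on the incoming boundary only, so \<open>b (entry x)\<close> is first restricted
  to the points that have an entry point.\<close>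

lemma borel_measurable_transported:
  assumes b: "b \<in> borel_measurable (restrict_space borel (Gamma_minus \<Phi> \<Omega>))"
  shows "transported b \<in> borel_measurable (restrict_space borel \<Omega> \<Otimes>\<^sub>M borel)"
proof -
  let ?N = "restrict_space borel \<Omega>"
  define B where "B x = (if tm x < \<infinity> then b (entry x) else 0)" for x
  have id [measurable]: "(\<lambda>x. x) \<in> measurable ?N borel"
    by (rule measurable_restrict_space1) simp
  have entry [measurable]: "entry \<in> measurable ?N borel"
    unfolding entry_def by measurable
  have [measurable]: "B \<in> borel_measurable ?N"
    unfolding B_def
  proof (rule iffD2[OF measurable_If_restrict_space_iff], goal_cases)
    case 1
    show "{x \<in> space ?N. tm x < \<infinity>} \<in> sets ?N" by measurable
  next
    case 2
    have "entry \<in> measurable (restrict_space ?N {x. tm x < \<infinity>}) (restrict_space borel (Gamma_minus \<Phi> \<Omega>))"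
      by (rule measurable_restrict_space2)
        (auto simp: space_restrict_space entry_in_Gamma_minus intro: measurable_restrict_space1 entry)
    from measurable_compose[OF this b]
    show ?case by simp
  qed
  have [measurable]: "bump \<in> borel_measurable borel"
    unfolding bump_def by measurable
  have eq: "transported b = (\<lambda>p. if tm (fst p) < ereal (snd p)
     then B (fst p) * bump (snd p - real_of_ereal (tm (fst p)))
       / real_of_ereal (min (tm (fst p) + tp (fst p)) (ereal (1 - snd p) + tm (fst p)))
     else 0)"
    by (auto simp: transported_def B_def fun_eq_iff)
  show ?thesis unfolding eq by measurable
qed

end

section \<open>Integration lemmas\<close>

lemma has_iterated_integral_cong:
  assumes "\<And>p. p \<in> space P \<Longrightarrow> L p = L' p"
  shows "has_iterated_integral P L h v \<longleftrightarrow> has_iterated_integral P L' h v"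
proof -
  have "(AE p in P. set_integrable lebesgue {s. 0 < s \<and> ereal s < L p} (h p)) \<longleftrightarrow>
      (AE p in P. set_integrable lebesgue {s. 0 < s \<and> ereal s < L' p} (h p))"
    by (rule AE_cong) (simp add: assms)
  moreover have "has_bochner_integral P (\<lambda>p. LINT s:{s. 0 < s \<and> ereal s < L p}|lebesgue. h p s) v \<longleftrightarrow>
      has_bochner_integral P (\<lambda>p. LINT s:{s. 0 < s \<and> ereal s < L' p}|lebesgue. h p s) v"
    by (rule has_bochner_integral_cong) (simp_all add: assms)
  ultimately show ?thesis by (simp add: has_iterated_integral_def)
qed

lemma has_bochner_integral_product:
  fixes g :: "'a \<Rightarrow> real" and k :: "'b \<Rightarrow> real"
  assumes "pair_sigma_finite P Q" and g: "integrable P g" and k: "integrable Q k"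
  shows "has_bochner_integral (P \<Otimes>\<^sub>M Q) (\<lambda>(x, t). g x * k t) ((\<integral>x. g x \<partial>P) * (\<integral>t. k t \<partial>Q))"
proof -
  interpret pair_sigma_finite P Q by fact
  have [measurable]: "g \<in> borel_measurable P" "k \<in> borel_measurable Q" using g k by auto
  have int: "integrable (P \<Otimes>\<^sub>M Q) (\<lambda>(x, t). g x * k t)"
  proof (rule Fubini_integrable)
    show "integrable P (\<lambda>x. \<integral>t. norm (case (x, t) of (x, t) \<Rightarrow> g x * k t) \<partial>Q)"
      using g by (simp add: abs_mult)
    show "AE x in P. integrable Q (\<lambda>t. case (x, t) of (x, t) \<Rightarrow> g x * k t)"
      using k by simp
  qed measurable
  have "(\<integral>z. (case z of (x, t) \<Rightarrow> g x * k t) \<partial>(P \<Otimes>\<^sub>M Q)) = (\<integral>x. (\<integral>t. g x * k t \<partial>Q) \<partial>P)"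
    by (rule integral_fst[OF int, symmetric])
  also have "\<dots> = (\<integral>x. g x \<partial>P) * (\<integral>t. k t \<partial>Q)"
    by simp
  finally show ?thesis using int by (simp add: has_bochner_integral_iff)
qed

lemma has_bochner_integral_unit_interval:
  fixes k K :: "real \<Rightarrow> real"
  assumes der: "\<And>t. (K has_real_derivative k t) (at t)" and cont: "continuous_on UNIV k"
  shows "has_bochner_integral (restrict_space lborel {0<..<1}) k (K 1 - K 0)"
    and "has_bochner_integral (lebesgue_on {0<..<1}) k (K 1 - K 0)"
proof -
  have [measurable]: "k \<in> borel_measurable borel" using cont by (rule borel_measurable_continuous_onI)
  have "has_bochner_integral lborel (\<lambda>t. k t * indicator {0..1} t) (K 1 - K 0)"
    using der cont
    by (intro has_bochner_integral_FTC_Icc_real) (auto simp: continuous_on_eq_continuous_at)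
  also have "has_bochner_integral lborel (\<lambda>t. k t * indicator {0..1} t) (K 1 - K 0) \<longleftrightarrow>
      has_bochner_integral lborel (\<lambda>t. indicator {0<..<1} t *\<^sub>R k t) (K 1 - K 0)"
  proof (rule has_bochner_integral_cong_AE)
    have "AE t in lborel. t \<noteq> (0::real) \<and> t \<noteq> 1"
      using AE_lborel_singleton[of "0::real"] AE_lborel_singleton[of "1::real"] by eventually_elim auto
    then show "AE t in lborel. k t * indicator {0..1} t = indicator {0<..<1} t *\<^sub>R k t"
      by eventually_elim (auto simp: indicator_def)
  qed auto
  finally have *: "has_bochner_integral lborel (\<lambda>t. indicator {0<..<1} t *\<^sub>R k t) (K 1 - K 0)" .
  then show "has_bochner_integral (restrict_space lborel {0<..<1}) k (K 1 - K 0)"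
    by (simp add: has_bochner_integral_iff integrable_restrict_space integral_restrict_space)
  from * have "has_bochner_integral lebesgue (\<lambda>t. indicator {0<..<1} t *\<^sub>R k t) (K 1 - K 0)"
    by (simp add: has_bochner_integral_iff integrable_completion integral_completion)
  then show "has_bochner_integral (lebesgue_on {0<..<1}) k (K 1 - K 0)"
    by (simp add: has_bochner_integral_iff integrable_restrict_space integral_restrict_space)
qed

lemma has_bochner_integral_constant_mean:
  assumes "0 < L"
  shows "has_bochner_integral lebesgue (\<lambda>s. indicator {0<..<L} s *\<^sub>R (c / L)) (c::real)"
proof -
  have "integrable lebesgue (indicator {0<..<L} :: real \<Rightarrow> real)"
    using assms by (intro integrable_real_indicator) auto
  then have "has_bochner_integral lebesgue (\<lambda>s. indicator {0<..<L} s * (c / L)) (measure lebesgue {0<..<L} * (c / L))"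
    by (simp add: has_bochner_integral_iff)
  then show ?thesis using assms by simp
qed

lemma bump_nonneg: "0 \<le> t \<Longrightarrow> t \<le> 1 \<Longrightarrow> 0 \<le> bump t"
  and bump_le: "0 \<le> t \<Longrightarrow> t \<le> 1 \<Longrightarrow> bump t \<le> 1"
  and bump_pos: "0 < t \<Longrightarrow> t < 1 \<Longrightarrow> 0 < bump t"
proof -
  assume t: "0 \<le> t" "t \<le> 1"
  show "0 \<le> bump t" using t by (simp add: bump_def)
  show "bump t \<le> 1" using mult_mono[of t 1 "1 - t" 1] t by (simp add: bump_def)
qed (simp add: bump_def)

lemma has_integral_bump:
  "has_bochner_integral (restrict_space lborel {0<..<1}) bump (1 / 6)"
  "has_bochner_integral (lebesgue_on {0<..<1}) bump (1 / 6)"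
proof -
  have der: "((\<lambda>t. t\<^sup>2 / 2 - t ^ 3 / 3) has_real_derivative bump t) (at t)" for t
    unfolding bump_def by (auto intro!: derivative_eq_intros simp: algebra_simps power2_eq_square)
  have cont: "continuous_on UNIV bump" unfolding bump_def by (intro continuous_intros)
  show "has_bochner_integral (restrict_space lborel {0<..<1}) bump (1 / 6)"
    "has_bochner_integral (lebesgue_on {0<..<1}) bump (1 / 6)"
    using has_bochner_integral_unit_interval[OF der cont] by simp_all
qed

lemma AE_unit_interval_ex:
  assumes "AE t in lebesgue_on {0<..<1::real}. R t"
  obtains t where "0 < t" "t < 1" "R t"
proof -
  have "emeasure (lebesgue_on {0<..<1::real}) (space (lebesgue_on {0<..<1})) \<noteq> 0"
    by (simp add: emeasure_restrict_space)
  then have "ae_filter (lebesgue_on {0<..<1::real}) \<noteq> bot"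
    by (simp add: ae_filter_eq_bot_iff)
  from eventually_happens'[OF this eventually_conj[OF assms AE_space]] that show thesis by auto
qed

text \<open>Completeness lets measurability pass to \<open>h\<close>, which may be any modification of \<open>f\<close> on a null set;
  traces are known only up to such modifications.\<close>

lemma has_bochner_integral_completion_AE:
  fixes f h :: "'a \<Rightarrow> real"
  assumes f: "has_bochner_integral (completion N) f v" and ae: "AE x in completion N. f x = h x"
  shows "has_bochner_integral (completion N) h v"
proof -
  have fm: "f \<in> borel_measurable (completion N)"
    using f by (auto simp: has_bochner_integral_iff)
  have "h \<in> borel_measurable (completion N)"
  proof (rule measurableI)
    fix A :: "real set" assume A: "A \<in> sets borel"
    show "h -` A \<inter> space (completion N) \<in> sets (completion N)"
    proof (rule completion.in_sets_AE)
      show "f -` A \<inter> space (completion N) \<in> sets (completion N)"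
        using fm A by (rule measurable_sets)
      show "AE x in completion N. x \<in> f -` A \<inter> space (completion N) \<longleftrightarrow> x \<in> h -` A \<inter> space (completion N)"
        using ae by eventually_elim auto
    qed auto
  qed simp
  from has_bochner_integral_cong_AE[OF fm this ae] f show ?thesis by simp
qed

lemma has_iterated_integral_nonneg:
  assumes h: "has_iterated_integral N L h v" and nn: "\<And>p s. 0 \<le> h p s"
  shows "0 \<le> v" and "v = 0 \<Longrightarrow> AE p in N. AE s in lebesgue. 0 < s \<and> ereal s < L p \<longrightarrow> h p s = 0"
proof -
  let ?I = "\<lambda>p. LINT s:{s. 0 < s \<and> ereal s < L p}|lebesgue. h p s"
  have int: "AE p in N. set_integrable lebesgue {s. 0 < s \<and> ereal s < L p} (h p)"
    and I: "integrable N ?I" "integral\<^sup>L N ?I = v"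
    using h by (simp_all add: has_iterated_integral_def has_bochner_integral_iff)
  have nnI: "AE p in N. 0 \<le> ?I p"
    by (rule AE_I2) (simp add: set_lebesgue_integral_def nn)
  show "0 \<le> v" using integral_nonneg_AE[OF nnI] I(2) by simp
  assume "v = 0"
  then have "AE p in N. ?I p = 0"
    using integral_nonneg_eq_0_iff_AE[OF I(1) nnI] I(2) by simp
  with int show "AE p in N. AE s in lebesgue. 0 < s \<and> ereal s < L p \<longrightarrow> h p s = 0"
  proof eventually_elim
    case (elim p)
    let ?S = "{s. 0 < s \<and> ereal s < L p}"
    have "AE s in lebesgue. indicator ?S s *\<^sub>R h p s = 0"
      using elim nn unfolding set_integrable_def set_lebesgue_integral_def
      by (subst integral_nonneg_eq_0_iff_AE[symmetric]) auto
    then show ?case by eventually_elim (auto simp: indicator_def)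
  qed
qed

section \<open>Integrals of transported functions\<close>

locale flow_in_measured_open_set = flow_in_open_set \<Phi> \<Omega>
  for \<Phi> :: "'a::euclidean_space \<Rightarrow> real \<Rightarrow> 'a" and \<Omega> +
  fixes M :: "'a measure"
  assumes radon: "radon_measure M"
begin

abbreviation "P \<equiv> restrict_space M \<Omega>"
abbreviation "Q \<equiv> restrict_space lborel {0<..<1::real}"

lemma space_M [simp]: "space M = UNIV"
  using radon by (auto simp: radon_measure_def dest: sets_eq_imp_space_eq)

lemma borel_subset_sets: "sets borel \<subseteq> sets M"
  using radon by (auto simp: radon_measure_def)

lemma domain_sets [measurable]: "\<Omega> \<in> sets M"
  using open_domain borel_subset_sets by auto

lemma emeasure_compact_finite: "compact K \<Longrightarrow> emeasure M K < \<infinity>"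
  using radon by (auto simp: radon_measure_def compact_imp_closed)

lemma sigma_finite_domain: "sigma_finite_measure P"
proof (rule sigma_finite_measure_restrict_space)
  show "sigma_finite_measure M"
  proof
    show "\<exists>A. countable A \<and> A \<subseteq> sets M \<and> \<Union>A = space M \<and> (\<forall>a\<in>A. emeasure M a \<noteq> \<infinity>)"
    proof (intro exI[of _ "range (\<lambda>n. cball 0 (real n))"] conjI ballI)
      show "range (\<lambda>n. cball (0::'a) (real n)) \<subseteq> sets M"
        using borel_subset_sets by auto
      show "\<Union>(range (\<lambda>n. cball (0::'a) (real n))) = space M"
        using real_arch_simple by (auto simp: dist_norm)
      show "emeasure M a \<noteq> \<infinity>" if "a \<in> range (\<lambda>n. cball 0 (real n))" for a
        using that emeasure_compact_finite by (auto simp: less_top[symmetric])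
    qed simp
  qed
qed (rule domain_sets)

lemma sigma_finite_unit_interval: "sigma_finite_measure Q"
  by (rule sigma_finite_measure_restrict_space[OF sigma_finite_lborel]) simp

sublocale PQ: pair_sigma_finite P Q
  using sigma_finite_domain sigma_finite_unit_interval by (rule pair_sigma_finite.intro)

lemma space_P [simp]: "space P = \<Omega>" and space_Q [simp]: "space Q = {0<..<1}"
  by (simp_all add: space_restrict_space)

lemma borel_measurable_transported_product [measurable]:
  assumes b: "b \<in> borel_measurable (restrict_space borel (Gamma_minus \<Phi> \<Omega>))"
  shows "transported b \<in> borel_measurable (P \<Otimes>\<^sub>M Q)"
proof (rule measurable_compose[OF _ borel_measurable_transported[OF b], where f = "\<lambda>z. z", simplified])
  have "(\<lambda>x. x) \<in> measurable P (restrict_space borel \<Omega>)"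
    using borel_subset_sets
    by (intro measurable_restrict_space2 measurable_restrict_space1) (auto simp: measurable_def)
  then have "(\<lambda>z. (fst z, snd z)) \<in> measurable (P \<Otimes>\<^sub>M Q) (restrict_space borel \<Omega> \<Otimes>\<^sub>M borel)"
    by (intro measurable_Pair measurable_compose[OF measurable_fst] measurable_compose[OF measurable_snd])
      (auto intro: measurable_restrict_space1)
  then show "(\<lambda>z. z) \<in> measurable (P \<Otimes>\<^sub>M Q) (restrict_space borel \<Omega> \<Otimes>\<^sub>M borel)" by simp
qed

text \<open>The defining formula with \<open>T = 1\<close>, and with the curve lengths on the boundary expressed by exit
  times.\<close>

lemma incomingD:
  assumes \<nu>: "incoming_boundary_measure M \<Phi> \<Omega> \<nu>" and f: "integrable (P \<Otimes>\<^sub>M Q) f"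
  obtains J a b where
    "AE t in lebesgue_on {0<..<1}. has_iterated_integral (completion \<nu>)
       (\<lambda>y. min (tp y) (ereal (1 - t))) (\<lambda>y s. f (\<Phi> y s, t + s)) (J t)"
    "has_bochner_integral (lebesgue_on {0<..<1}) J a"
    "has_iterated_integral P (\<lambda>x. min (tp x) (ereal 1)) (\<lambda>x s. f (\<Phi> x s, s)) b"
    "(\<integral>z. f z \<partial>(P \<Otimes>\<^sub>M Q)) = a + b"
proof -
  have "space \<nu> = Gamma_minus \<Phi> \<Omega>"
    using \<nu> sets_eq_imp_space_eq[of \<nu> "restrict_space borel (Gamma_minus \<Phi> \<Omega>)"]
    by (auto simp: incoming_boundary_measure_def space_restrict_space)
  then have "has_iterated_integral (completion \<nu>) (\<lambda>y. min (length_from \<Phi> \<Omega> y) (ereal r)) h v \<longleftrightarrow>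
      has_iterated_integral (completion \<nu>) (\<lambda>y. min (tp y) (ereal r)) h v" for r h v
    by (intro has_iterated_integral_cong) (simp add: Gamma_minus_props)
  then show thesis
    using \<nu> f that unfolding incoming_boundary_measure_def by (auto dest!: spec[of _ "1::real"])
qed

lemma outgoingD:
  assumes \<nu>: "outgoing_boundary_measure M \<Phi> \<Omega> \<nu>" and f: "integrable (P \<Otimes>\<^sub>M Q) f"
  obtains J a b where
    "AE t in lebesgue_on {0<..<1}. has_iterated_integral (completion \<nu>)
       (\<lambda>y. min (tm y) (ereal t)) (\<lambda>y s. f (\<Phi> y (- s), t - s)) (J t)"
    "has_bochner_integral (lebesgue_on {0<..<1}) J a"
    "has_iterated_integral P (\<lambda>x. min (tm x) (ereal 1)) (\<lambda>x s. f (\<Phi> x (- s), 1 - s)) b"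
    "(\<integral>z. f z \<partial>(P \<Otimes>\<^sub>M Q)) = a + b"
proof -
  have "space \<nu> = Gamma_plus \<Phi> \<Omega>"
    using \<nu> sets_eq_imp_space_eq[of \<nu> "restrict_space borel (Gamma_plus \<Phi> \<Omega>)"]
    by (auto simp: outgoing_boundary_measure_def space_restrict_space)
  then have "has_iterated_integral (completion \<nu>) (\<lambda>y. min (length_to \<Phi> \<Omega> y) (ereal r)) h v \<longleftrightarrow>
      has_iterated_integral (completion \<nu>) (\<lambda>y. min (tm y) (ereal r)) h v" for r h v
    by (intro has_iterated_integral_cong) (simp add: Gamma_plus_props)
  then show thesis
    using \<nu> f that unfolding outgoing_boundary_measure_def by (auto dest!: spec[of _ "1::real"])
qed

text \<open>The incoming formula concerns integrable functions, so it is first applied to integrable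
  truncations of \<open>\<bar>u\<bar>\<close>. Along each curve these integrate to at most \<open>\<bar>b\<bar>\<close>, whence a bound that is
  uniform in the truncation, and monotone convergence gives the claim.\<close>

lemma integrable_transported:
  assumes \<nu>: "incoming_boundary_measure M \<Phi> \<Omega> \<nu>" and b: "integrable \<nu> b"
  shows "integrable (P \<Otimes>\<^sub>M Q) (transported b)"
proof -
  have sets\<nu>: "sets \<nu> = sets (restrict_space borel (Gamma_minus \<Phi> \<Omega>))"
    using \<nu> by (simp add: incoming_boundary_measure_def)
  have space\<nu>: "space \<nu> = Gamma_minus \<Phi> \<Omega>"
    using sets_eq_imp_space_eq[OF sets\<nu>] by (simp add: space_restrict_space)
  have meas [measurable]: "transported b \<in> borel_measurable (P \<Otimes>\<^sub>M Q)"
    using b borel_measurable_integrable measurable_cong_sets[OF sets\<nu> refl]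
    by (intro borel_measurable_transported_product) blast
  define C where "C = (\<integral>y. \<bar>b y\<bar> \<partial>completion \<nu>)"
  define v where "v n z = indicator (cball 0 (real n)) (fst z) * min \<bar>transported b z\<bar> (real n)" for n z
  have ball: "{z \<in> space (P \<Otimes>\<^sub>M Q). fst z \<in> cball 0 (real n)} \<in> sets (P \<Otimes>\<^sub>M Q)" for n
  proof -
    have "cball 0 (real n) \<inter> \<Omega> \<in> sets P"
      using borel_subset_sets domain_sets by (auto simp: sets_restrict_space_iff intro!: sets.Int)
    then have "(cball 0 (real n) \<inter> \<Omega>) \<times> space Q \<in> sets (P \<Otimes>\<^sub>M Q)"
      by (rule pair_measureI) (rule sets.top)
    also have "(cball 0 (real n) \<inter> \<Omega>) \<times> space Q = {z \<in> space (P \<Otimes>\<^sub>M Q). fst z \<in> cball 0 (real n)}"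
      by (auto simp: space_pair_measure)
    finally show ?thesis .
  qed
  have v_meas [measurable]: "v n \<in> borel_measurable (P \<Otimes>\<^sub>M Q)" for n
  proof -
    have [measurable]: "(\<lambda>z. indicator (cball 0 (real n)) (fst z) :: real) \<in> borel_measurable (P \<Otimes>\<^sub>M Q)"
      using ball[of n] by (intro borel_measurable_indicator') (simp add: vimage_def Int_def conj_commute)
    show ?thesis unfolding v_def by measurable
  qed
  have v_int: "integrable (P \<Otimes>\<^sub>M Q) (v n)" for n
  proof (rule integrableI_bounded_set[OF ball[of n] v_meas])
    have "{z \<in> space (P \<Otimes>\<^sub>M Q). fst z \<in> cball 0 (real n)} = (cball 0 (real n) \<inter> \<Omega>) \<times> {0<..<1}"
      by (auto simp: space_pair_measure)
    moreover have "cball 0 (real n) \<inter> \<Omega> \<in> sets P"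
      using borel_subset_sets domain_sets by (auto simp: sets_restrict_space_iff intro!: sets.Int)
    ultimately have "emeasure (P \<Otimes>\<^sub>M Q) {z \<in> space (P \<Otimes>\<^sub>M Q). fst z \<in> cball 0 (real n)}
        = emeasure P (cball 0 (real n) \<inter> \<Omega>) * emeasure Q {0<..<1}"
      by (simp add: PQ.M2.emeasure_pair_measure_Times sets_restrict_space_iff)
    also have "emeasure Q {0<..<1} = 1" by (simp add: emeasure_restrict_space)
    also have "emeasure P (cball 0 (real n) \<inter> \<Omega>) = emeasure M (cball 0 (real n) \<inter> \<Omega>)"
      by (simp add: emeasure_restrict_space)
    also have "\<dots> \<le> emeasure M (cball 0 (real n))"
      using borel_subset_sets by (intro emeasure_mono) auto
    also have "\<dots> < \<infinity>" by (rule emeasure_compact_finite) simp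
    finally show "emeasure (P \<Otimes>\<^sub>M Q) {z \<in> space (P \<Otimes>\<^sub>M Q). fst z \<in> cball 0 (real n)} < \<infinity>" by simp
    show "AE z\<in>{z \<in> space (P \<Otimes>\<^sub>M Q). fst z \<in> cball 0 (real n)} in P \<Otimes>\<^sub>M Q. norm (v n z) \<le> real n"
      by (auto simp: v_def)
    show "AE z in P \<Otimes>\<^sub>M Q. z \<notin> {z \<in> space (P \<Otimes>\<^sub>M Q). fst z \<in> cball 0 (real n)} \<longrightarrow> v n z = 0"
      by (rule AE_I2) (simp add: v_def)
  qed
  have le: "(\<integral>z. v n z \<partial>(P \<Otimes>\<^sub>M Q)) \<le> C" for n
  proof -
    obtain J a c where J: "AE t in lebesgue_on {0<..<1}. has_iterated_integral (completion \<nu>)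
         (\<lambda>y. min (tp y) (ereal (1 - t))) (\<lambda>y s. v n (\<Phi> y s, t + s)) (J t)"
      and a: "has_bochner_integral (lebesgue_on {0<..<1}) J a"
      and c: "has_iterated_integral P (\<lambda>x. min (tp x) (ereal 1)) (\<lambda>x s. v n (\<Phi> x s, s)) c"
      and sum: "(\<integral>z. v n z \<partial>(P \<Otimes>\<^sub>M Q)) = a + c"
      using incomingD[OF \<nu> v_int] by blast
    have inner: "(LINT s:{s. 0 < s \<and> ereal s < min (tp y) (ereal (1 - t))}|lebesgue. v n (\<Phi> y s, t + s)) \<le> \<bar>b y\<bar>"
      if y: "y \<in> Gamma_minus \<Phi> \<Omega>" and t: "0 < t" "t < 1" and
        int: "set_integrable lebesgue {s. 0 < s \<and> ereal s < min (tp y) (ereal (1 - t))} (\<lambda>s. v n (\<Phi> y s, t + s))"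
      for y t
    proof -
      define L where "L = real_of_ereal (min (tp y) (ereal (1 - t)))"
      have L: "min (tp y) (ereal (1 - t)) = ereal L"
        using Gamma_minus_props(2)[OF y] unfolding L_def by (cases "tp y") (auto simp: min_def)
      have "0 < min (tp y) (ereal (1 - t))"
        using Gamma_minus_props(2)[OF y] t by simp
      then have "0 < L" using L by simp
      have S: "{s. 0 < s \<and> ereal s < min (tp y) (ereal (1 - t))} = {0<..<L}"
        using L by auto
      note const = has_bochner_integral_constant_mean[OF \<open>0 < L\<close>, of "\<bar>b y\<bar> * bump t"]
      have "(LINT s:{0<..<L}|lebesgue. v n (\<Phi> y s, t + s)) \<le> (LINT s:{0<..<L}|lebesgue. \<bar>b y\<bar> * bump t / L)"
      proof (rule set_integral_mono)
        show "set_integrable lebesgue {0<..<L} (\<lambda>s. v n (\<Phi> y s, t + s))" using int S by simp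
        show "set_integrable lebesgue {0<..<L} (\<lambda>s. \<bar>b y\<bar> * bump t / L)"
          using const by (simp add: set_integrable_def has_bochner_integral_iff)
        fix s assume s: "s \<in> {0<..<L}"
        have "v n (\<Phi> y s, t + s) \<le> \<bar>transported b (\<Phi> y s, t + s)\<bar>"
          by (simp add: v_def indicator_def)
        also have "transported b (\<Phi> y s, t + s) = b y * bump t / L"
          unfolding L_def using Gamma_minus_props[OF y] t s L
          by (intro transported_from_entry) auto
        also have "\<bar>\<dots>\<bar> = \<bar>b y\<bar> * bump t / L"
          using \<open>0 < L\<close> t bump_nonneg[of t] by (simp add: abs_mult)
        finally show "v n (\<Phi> y s, t + s) \<le> \<bar>b y\<bar> * bump t / L" .
      qed
      also have "\<dots> = \<bar>b y\<bar> * bump t"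
        using has_bochner_integral_integral_eq[OF const] unfolding set_lebesgue_integral_def .
      also have "\<dots> \<le> \<bar>b y\<bar>"
        using bump_le[of t] t by (simp add: mult_left_le)
      finally show ?thesis using S by simp
    qed
    have intb: "integrable (completion \<nu>) (\<lambda>y. \<bar>b y\<bar>)"
      using b by (subst integrable_completion) auto
    have J_le: "AE t in lebesgue_on {0<..<1}. J t \<le> C"
      using J AE_space
    proof eventually_elim
      case (elim t)
      let ?I = "\<lambda>y. LINT s:{s. 0 < s \<and> ereal s < min (tp y) (ereal (1 - t))}|lebesgue. v n (\<Phi> y s, t + s)"
      have le: "AE y in completion \<nu>. ?I y \<le> \<bar>b y\<bar>"
        using elim(1)[unfolded has_iterated_integral_def, THEN conjunct1] AE_space
        by eventually_elim (use elim(2) inner space\<nu> in auto)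
      have I: "integrable (completion \<nu>) ?I" "integral\<^sup>L (completion \<nu>) ?I = J t"
        using elim(1) by (simp_all add: has_iterated_integral_def has_bochner_integral_iff)
      show "J t \<le> C"
        unfolding C_def I(2)[symmetric] by (rule integral_mono_AE[OF I(1) intb le])
    qed
    have int1: "has_bochner_integral (lebesgue_on {0<..<1::real}) (\<lambda>_. C) C"
      using has_bochner_integral_unit_interval(2)[of "\<lambda>t. C * t" "\<lambda>_. C"]
      by (auto intro!: derivative_eq_intros)
    have "a = integral\<^sup>L (lebesgue_on {0<..<1}) J"
      using a by (simp add: has_bochner_integral_iff)
    also have "\<dots> \<le> (\<integral>t. C \<partial>lebesgue_on {0<..<1::real})"
      using a int1 by (intro integral_mono_AE[OF _ _ J_le]) (simp_all add: has_bochner_integral_iff)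
    also have "\<dots> = C"
      using has_bochner_integral_integral_eq[OF int1] .
    finally have "a \<le> C" .
    moreover have "c = 0"
    proof -
      have zero: "(LINT s:{s. 0 < s \<and> ereal s < min (tp x) (ereal 1)}|lebesgue. v n (\<Phi> x s, s)) = 0"
        if "x \<in> space P" for x
      proof -
        have "v n (\<Phi> x s, s) = 0" if "0 < s" "ereal s < min (tp x) (ereal 1)" for s
          using transported_from_initial_time[of x s b] that \<open>x \<in> space P\<close> by (simp add: v_def)
        then have "(\<lambda>s. indicator {s. 0 < s \<and> ereal s < min (tp x) (ereal 1)} s *\<^sub>R v n (\<Phi> x s, s)) = (\<lambda>_. 0)"
          by (auto simp: fun_eq_iff indicator_def)
        then show ?thesis by (simp add: set_lebesgue_integral_def)
      qed
      have "c = (\<integral>x. (LINT s:{s. 0 < s \<and> ereal s < min (tp x) (ereal 1)}|lebesgue. v n (\<Phi> x s, s)) \<partial>P)"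
        using c by (simp add: has_iterated_integral_def has_bochner_integral_iff)
      also have "\<dots> = (\<integral>x. 0 \<partial>P)"
        by (rule Bochner_Integration.integral_cong[OF refl zero])
      finally show ?thesis by simp
    qed
    ultimately show ?thesis using sum by simp
  qed
  have bound: "(\<integral>\<^sup>+z. ennreal (v n z) \<partial>(P \<Otimes>\<^sub>M Q)) \<le> ennreal C" for n
  proof -
    have "(\<integral>\<^sup>+z. ennreal (v n z) \<partial>(P \<Otimes>\<^sub>M Q)) = ennreal (\<integral>z. v n z \<partial>(P \<Otimes>\<^sub>M Q))"
      by (rule nn_integral_eq_integral[OF v_int]) (simp add: v_def)
    with le[of n] show ?thesis by (simp add: ennreal_leI)
  qed
  have "(SUP n. ennreal (v n z)) = ennreal (norm (transported b z))" for z
  proof (rule SUP_eqI)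
    show "ennreal (v n z) \<le> ennreal (norm (transported b z))" for n
      by (rule ennreal_leI) (simp add: v_def indicator_def)
    fix y assume y: "\<And>n. n \<in> UNIV \<Longrightarrow> ennreal (v n z) \<le> y"
    obtain n where n: "max (norm (fst z)) \<bar>transported b z\<bar> \<le> real n"
      using real_arch_simple by blast
    then have "v n z = \<bar>transported b z\<bar>" by (simp add: v_def)
    then show "ennreal (norm (transported b z)) \<le> y" using y[of n] by simp
  qed
  then have "(\<integral>\<^sup>+z. ennreal (norm (transported b z)) \<partial>(P \<Otimes>\<^sub>M Q))
      = (\<integral>\<^sup>+z. (SUP n. ennreal (v n z)) \<partial>(P \<Otimes>\<^sub>M Q))" by simp
  also have "\<dots> = (SUP n. \<integral>\<^sup>+z. ennreal (v n z) \<partial>(P \<Otimes>\<^sub>M Q))"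
  proof (rule nn_integral_monotone_convergence_SUP)
    show "incseq (\<lambda>n z. ennreal (v n z))"
    proof (intro incseq_SucI le_funI ennreal_leI)
      fix n z
      show "v n z \<le> v (Suc n) z"
        unfolding v_def by (intro mult_mono) (auto simp: indicator_def)
    qed
  qed measurable
  also have "\<dots> \<le> ennreal C" using bound by (auto intro: SUP_least)
  also have "\<dots> < \<infinity>" by simp
  finally show ?thesis by (intro integrableI_bounded meas)
qed

lemma transported_outgoing_inner:
  assumes z: "z \<notin> \<Omega> \<or> t = 1" and t: "0 < t" "t \<le> 1" and "0 < tm z"
  shows "has_bochner_integral lebesgue
    (\<lambda>s. indicator {s. 0 < s \<and> ereal s < min (tm z) (ereal t)} s *\<^sub>R transported b (\<Phi> z (- s), t - s))
    (if tm z < ereal t then b (entry z) * bump (t - real_of_ereal (tm z)) else 0)"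
proof (cases "tm z < ereal t")
  case True
  then obtain r where r: "tm z = ereal r" "0 < r" "r < t"
    using \<open>0 < tm z\<close> by (cases "tm z") auto
  have "indicator {0<..<r} s *\<^sub>R (b (entry z) * bump (t - r) / r) =
      indicator {s. 0 < s \<and> ereal s < min (tm z) (ereal t)} s *\<^sub>R transported b (\<Phi> z (- s), t - s)" for s
    using transported_backward[OF z t, of s b] r by (auto simp: indicator_def)
  then show ?thesis
    using has_bochner_integral_constant_mean[OF r(2), of "b (entry z) * bump (t - r)"] r by simp
next
  case False
  then have "(\<lambda>s. indicator {s. 0 < s \<and> ereal s < min (tm z) (ereal t)} s *\<^sub>R transported b (\<Phi> z (- s), t - s)) = (\<lambda>_. 0)"
    using transported_backward[OF z t, of _ b] by (auto simp: indicator_def fun_eq_iff)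
  then show ?thesis using False by (simp add: has_bochner_integral_zero)
qed

lemma transported_incoming_inner:
  assumes y: "y \<in> Gamma_minus \<Phi> \<Omega>" and t: "0 < t" "t < 1"
  shows "(LINT s:{s. 0 < s \<and> ereal s < min (tp y) (ereal (1 - t))}|lebesgue. transported b (\<Phi> y s, t + s)) = b y * bump t"
proof -
  define L where "L = real_of_ereal (min (tp y) (ereal (1 - t)))"
  have L: "min (tp y) (ereal (1 - t)) = ereal L"
    using Gamma_minus_props(2)[OF y] unfolding L_def by (cases "tp y") (auto simp: min_def)
  have "0 < min (tp y) (ereal (1 - t))"
    using Gamma_minus_props(2)[OF y] t by simp
  then have "0 < L" using L by simp
  have "indicator {0<..<L} s *\<^sub>R (b y * bump t / L) =
      indicator {s. 0 < s \<and> ereal s < min (tp y) (ereal (1 - t))} s *\<^sub>R transported b (\<Phi> y s, t + s)" for s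
    using transported_from_entry[of y s t b] Gamma_minus_props(1)[OF y] t L by (auto simp: indicator_def L_def[symmetric])
  then show ?thesis
    using has_bochner_integral_integral_eq[OF has_bochner_integral_constant_mean[OF \<open>0 < L\<close>, of "b y * bump t"]]
    by (simp add: set_lebesgue_integral_def)
qed

lemma integral_transported:
  assumes \<nu>: "incoming_boundary_measure M \<Phi> \<Omega> \<nu>" and b: "integrable \<nu> b"
  shows "(\<integral>z. transported b z \<partial>(P \<Otimes>\<^sub>M Q)) = (\<integral>y. b y \<partial>\<nu>) / 6"
proof -
  have space\<nu>: "space \<nu> = Gamma_minus \<Phi> \<Omega>"
    using \<nu> sets_eq_imp_space_eq[of \<nu> "restrict_space borel (Gamma_minus \<Phi> \<Omega>)"]
    by (auto simp: incoming_boundary_measure_def space_restrict_space)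
  obtain J a c where J: "AE t in lebesgue_on {0<..<1}. has_iterated_integral (completion \<nu>)
       (\<lambda>y. min (tp y) (ereal (1 - t))) (\<lambda>y s. transported b (\<Phi> y s, t + s)) (J t)"
    and a: "has_bochner_integral (lebesgue_on {0<..<1}) J a"
    and c: "has_iterated_integral P (\<lambda>x. min (tp x) (ereal 1)) (\<lambda>x s. transported b (\<Phi> x s, s)) c"
    and sum: "(\<integral>z. transported b z \<partial>(P \<Otimes>\<^sub>M Q)) = a + c"
    using incomingD[OF \<nu> integrable_transported[OF \<nu> b]] by blast
  have J_eq: "AE t in lebesgue_on {0<..<1}. J t = bump t * (\<integral>y. b y \<partial>\<nu>)"
    using J AE_space
  proof eventually_elim
    case (elim t)
    have "J t = (\<integral>y. (LINT s:{s. 0 < s \<and> ereal s < min (tp y) (ereal (1 - t))}|lebesgue. transported b (\<Phi> y s, t + s)) \<partial>completion \<nu>)"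
      using elim(1) by (simp add: has_iterated_integral_def has_bochner_integral_iff)
    also have "\<dots> = (\<integral>y. b y * bump t \<partial>completion \<nu>)"
      using elim(2) by (intro Bochner_Integration.integral_cong refl transported_incoming_inner) (simp_all add: space\<nu>)
    also have "\<dots> = bump t * (\<integral>y. b y \<partial>\<nu>)"
      using b by (simp add: integral_completion)
    finally show ?case .
  qed
  have "a = (\<integral>y. b y \<partial>\<nu>) / 6"
    using has_bochner_integral_eq_AE[OF a has_bochner_integral_mult_left[OF has_integral_bump(2)] J_eq] by simp
  moreover have "c = 0"
  proof -
    have zero: "(LINT s:{s. 0 < s \<and> ereal s < min (tp x) (ereal 1)}|lebesgue. transported b (\<Phi> x s, s)) = 0"
      if "x \<in> space P" for x
    proof -
      have "(\<lambda>s. indicator {s. 0 < s \<and> ereal s < min (tp x) (ereal 1)} s *\<^sub>R transported b (\<Phi> x s, s)) = (\<lambda>_. 0)"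
        using transported_from_initial_time[of x _ b] that by (auto simp: fun_eq_iff indicator_def)
      then show ?thesis by (simp add: set_lebesgue_integral_def)
    qed
    have "c = (\<integral>x. (LINT s:{s. 0 < s \<and> ereal s < min (tp x) (ereal 1)}|lebesgue. transported b (\<Phi> x s, s)) \<partial>P)"
      using c by (simp add: has_iterated_integral_def has_bochner_integral_iff)
    also have "\<dots> = (\<integral>x. 0 \<partial>P)"
      by (rule Bochner_Integration.integral_cong[OF refl zero])
    finally show ?thesis by simp
  qed
  ultimately show ?thesis using sum by simp
qed

section \<open>Null sets along curves\<close>

text \<open>Both contributions to the outgoing formula for \<open>\<bar>q\<bar>\<close> are nonnegative and their sum is zero.
  With \<open>q\<close> an indicator function this says that almost every curve spends no time in a null set.\<close>

lemma null_along_outgoing: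
  fixes q :: "'a \<times> real \<Rightarrow> real"
  assumes \<nu>: "outgoing_boundary_measure M \<Phi> \<Omega> \<nu>" and q: "integrable (P \<Otimes>\<^sub>M Q) q"
    and null: "(\<integral>z. \<bar>q z\<bar> \<partial>(P \<Otimes>\<^sub>M Q)) = 0"
  shows "AE t in lebesgue_on {0<..<1}. AE y in completion \<nu>. AE s in lebesgue.
      0 < s \<and> ereal s < min (tm y) (ereal t) \<longrightarrow> q (\<Phi> y (- s), t - s) = 0"
    and "AE x in P. AE s in lebesgue. 0 < s \<and> ereal s < min (tm x) (ereal 1) \<longrightarrow> q (\<Phi> x (- s), 1 - s) = 0"
proof -
  have q': "integrable (P \<Otimes>\<^sub>M Q) (\<lambda>z. \<bar>q z\<bar>)" using integrable_norm[OF q] by simp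
  obtain J a c where J: "AE t in lebesgue_on {0<..<1}. has_iterated_integral (completion \<nu>)
       (\<lambda>y. min (tm y) (ereal t)) (\<lambda>y s. \<bar>q (\<Phi> y (- s), t - s)\<bar>) (J t)"
    and a: "has_bochner_integral (lebesgue_on {0<..<1}) J a"
    and c: "has_iterated_integral P (\<lambda>x. min (tm x) (ereal 1)) (\<lambda>x s. \<bar>q (\<Phi> x (- s), 1 - s)\<bar>) c"
    and sum: "(\<integral>z. \<bar>q z\<bar> \<partial>(P \<Otimes>\<^sub>M Q)) = a + c"
    using outgoingD[OF \<nu> q'] by blast
  have J_nn: "AE t in lebesgue_on {0<..<1}. 0 \<le> J t"
    using J by eventually_elim (rule has_iterated_integral_nonneg(1), auto)
  have a': "integrable (lebesgue_on {0<..<1}) J" "integral\<^sup>L (lebesgue_on {0<..<1}) J = a"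
    using a by (simp_all add: has_bochner_integral_iff)
  have "0 \<le> a" using integral_nonneg_AE[OF J_nn] a'(2) by simp
  moreover have "0 \<le> c" by (rule has_iterated_integral_nonneg(1)[OF c]) simp
  ultimately have ac: "a = 0" "c = 0" using sum null by auto
  have "AE t in lebesgue_on {0<..<1}. J t = 0"
    using integral_nonneg_eq_0_iff_AE[OF a'(1) J_nn] a'(2) ac by simp
  with J show "AE t in lebesgue_on {0<..<1}. AE y in completion \<nu>. AE s in lebesgue.
      0 < s \<and> ereal s < min (tm y) (ereal t) \<longrightarrow> q (\<Phi> y (- s), t - s) = 0"
  proof eventually_elim
    case (elim t)
    from has_iterated_integral_nonneg(2)[OF elim(1) _ elim(2)] show ?case by simp
  qed
  from has_iterated_integral_nonneg(2)[OF c _ ac(2)]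
  show "AE x in P. AE s in lebesgue. 0 < s \<and> ereal s < min (tm x) (ereal 1) \<longrightarrow> q (\<Phi> x (- s), 1 - s) = 0"
    by simp
qed

section \<open>Green's formula\<close>

text \<open>The heart of the proof, on a single curve that is followed backwards from \<open>z\<close> at time \<open>t\<close>. The
  point \<open>\<Phi> z (- s0)\<close> is one curve point at which the integral identity for \<open>fs\<close> is known; as
  that identity concerns the whole curve, a single such point is enough.\<close>

lemma backward_integral:
  fixes f fs g b :: "'a \<Rightarrow> real"
  defines "w \<equiv> \<lambda>(x, t). f x * (1 - 2 * t) - g x * bump t + transported b (x, t)"
  assumes z: "z \<notin> \<Omega> \<or> t = 1" and t: "0 < t" "t \<le> 1" and pos: "0 < tm z"
    and G: "set_integrable lebesgue {s. 0 < s \<and> ereal s < min (tm z) (ereal t)} (\<lambda>s. g (\<Phi> z (- s)))"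
    and s0: "0 < s0" "ereal s0 < min (tm z) (ereal t)"
    and sharp: "\<And>t1 t2. - tm (\<Phi> z (- s0)) < ereal t1 \<Longrightarrow> t1 \<le> t2 \<Longrightarrow> ereal t2 < tp (\<Phi> z (- s0)) \<Longrightarrow>
      fs (\<Phi> (\<Phi> z (- s0)) t1) - fs (\<Phi> (\<Phi> z (- s0)) t2) = (LINT s:{t1..t2}|lebesgue. g (\<Phi> (\<Phi> z (- s0)) s))"
    and q: "AE s in lebesgue. 0 < s \<and> ereal s < min (tm z) (ereal t) \<longrightarrow> f (\<Phi> z (- s)) = fs (\<Phi> z (- s))"
    and b: "tm z < ereal t \<Longrightarrow> b (entry z) = trace_minus \<Phi> fs (entry z)"
  shows "(LINT s:{s. 0 < s \<and> ereal s < min (tm z) (ereal t)}|lebesgue. w (\<Phi> z (- s), t - s))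
    = bump t * trace_plus \<Phi> fs z"
proof -
  define L where "L = real_of_ereal (min (tm z) (ereal t))"
  have L: "min (tm z) (ereal t) = ereal L"
    using pos unfolding L_def by (cases "tm z") (auto simp: min_def)
  have "0 < min (tm z) (ereal t)" using pos t by simp
  then have "0 < L" using L by simp
  have S: "{s. 0 < s \<and> ereal s < min (tm z) (ereal t)} = {0<..<L}"
    using L by auto
  have L_le: "ereal L \<le> tm z" using L min.cobounded1[of "tm z" "ereal t"] by simp
  define p where "p s = fs (\<Phi> z (- s))" for s
  have s0': "s0 < L" using s0 L by simp
  have p: "p s1 - p s2 = (LINT s:{s2..s1}|lebesgue. g (\<Phi> z (- s)))" if s: "0 < s2" "s2 \<le> s1" "s1 < L" for s1 s2
  proof -
    \<comment> \<open>the identity at \<open>\<Phi> z (- s0)\<close> is used with times shifted by \<open>s0\<close>\<close>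
    have 1: "ereal s0 + tm (\<Phi> z (- s0)) = tm z"
      using s0 by (intro tau_minus_flow) auto
    have "ereal s1 < tm z" using s(3) L_le by (meson ereal_less(2) less_ereal.simps(1) less_le_trans)
    then have lower: "- tm (\<Phi> z (- s0)) < ereal (s0 - s1)"
      using 1[symmetric] tau_minus_nonneg[of "\<Phi> z (- s0)"] by (cases "tm (\<Phi> z (- s0))") auto
    have "ereal s0 \<le> tp (\<Phi> z (- s0))"
      unfolding le_tau_plus_iff
    proof (intro allI impI)
      fix s assume s: "0 < s \<and> s < s0"
      have "ereal (s0 - s) < tm z" using s s0' L_le by (auto intro: less_le_trans[of _ "ereal L"])
      then show "\<Phi> (\<Phi> z (- s0)) s \<in> \<Omega>"
        using less_tau_minusD[of "s0 - s" z] s by (simp add: flow_flow)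
    qed
    then have upper: "ereal (s0 - s2) < tp (\<Phi> z (- s0))"
      using s(1) by (auto intro: less_le_trans[of _ "ereal s0"])
    have "p s1 - p s2 = fs (\<Phi> (\<Phi> z (- s0)) (s0 - s1)) - fs (\<Phi> (\<Phi> z (- s0)) (s0 - s2))"
      by (simp add: p_def flow_flow)
    also have "\<dots> = (LINT s:{s0 - s1..s0 - s2}|lebesgue. g (\<Phi> (\<Phi> z (- s0)) s))"
      using sharp[OF lower _ upper] s(2) by simp
    also have "\<dots> = (\<integral>s. indicator {s0 - s1..s0 - s2} (s0 + - 1 * s) *\<^sub>R g (\<Phi> (\<Phi> z (- s0)) (s0 + - 1 * s)) \<partial>lebesgue)"
      unfolding set_lebesgue_integral_def by (subst lebesgue_integral_real_affine[where c = "-1" and t = s0]) simp_all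
    also have "\<dots> = (LINT s:{s2..s1}|lebesgue. g (\<Phi> z (- s)))"
      unfolding set_lebesgue_integral_def
      by (intro Bochner_Integration.integral_cong refl) (auto simp: indicator_def flow_flow)
    finally show ?thesis .
  qed
  have q': "AE s in lebesgue. 0 < s \<and> s < L \<longrightarrow> f (\<Phi> z (- s)) = p s"
    using q by eventually_elim (simp add: L p_def)
  have der: "((\<lambda>s. bump (t - s)) has_real_derivative - (1 - 2 * (t - s))) (at s)" for s
    unfolding bump_def by (auto intro!: derivative_eq_intros simp: algebra_simps)
  obtain A B where A: "(p \<longlongrightarrow> A) (at_right 0)" and B: "(p \<longlongrightarrow> B) (at_left L)"
    and AB: "has_bochner_integral lebesgue (\<lambda>s. indicator {0<..<L} s *\<^sub>R
      (f (\<Phi> z (- s)) * - (1 - 2 * (t - s)) + g (\<Phi> z (- s)) * bump (t - s))) (B * bump (t - L) - A * bump (t - 0))"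
    by (rule integral_product_rule_open_interval[OF \<open>0 < L\<close> G[unfolded S] p q' der])
      (auto intro!: continuous_intros)
  have trace: "trace_plus \<Phi> fs z = A"
    unfolding trace_plus_def using tendsto_Lim[OF _ A] by (simp add: p_def[abs_def])
  let ?T = "if tm z < ereal t then b (entry z) * bump (t - real_of_ereal (tm z)) else 0"
  \<comment> \<open>the curve either entered at \<open>\<Phi> z (- L)\<close>, where the incoming trace is the limit \<open>B\<close>,
    or reached time \<open>0\<close>, where \<open>bump\<close> vanishes\<close>
  have T: "?T = B * bump (t - L)"
  proof (cases "tm z < ereal t")
    case True
    then have r: "tm z = ereal L" using L by (simp add: min_def less_imp_le)
    have "((\<lambda>\<tau>. p (L - \<tau>)) \<longlongrightarrow> B) (at_right 0)"
    proof (rule filterlim_compose[OF B])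
      have "((\<lambda>\<tau>. L - \<tau>) \<longlongrightarrow> L - 0) (at_right 0)" by (intro tendsto_intros)
      then show "filterlim (\<lambda>\<tau>. L - \<tau>) (at_left L) (at_right 0)"
        by (simp add: filterlim_at eventually_at_filter)
    qed
    moreover have "p (L - \<tau>) = fs (\<Phi> (entry z) \<tau>)" for \<tau>
      by (simp add: p_def entry_def r flow_flow)
    ultimately have "trace_minus \<Phi> fs (entry z) = B"
      unfolding trace_minus_def by (intro tendsto_Lim) auto
    then show ?thesis using b[OF True] True r by simp
  next
    case False
    then have "L = t" using L by (simp add: min_def split: if_splits)
    then show ?thesis using False by (simp add: bump_def)
  qed
  have "has_bochner_integral lebesgue
      (\<lambda>s. indicator {0<..<L} s *\<^sub>R transported b (\<Phi> z (- s), t - s)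
        - indicator {0<..<L} s *\<^sub>R (f (\<Phi> z (- s)) * - (1 - 2 * (t - s)) + g (\<Phi> z (- s)) * bump (t - s)))
      (?T - (B * bump (t - L) - A * bump (t - 0)))"
    using has_bochner_integral_diff[OF transported_outgoing_inner[OF z t pos, of b, unfolded S] AB] .
  also have "?T - (B * bump (t - L) - A * bump (t - 0)) = bump t * trace_plus \<Phi> fs z"
    unfolding T trace by simp
  also have "(\<lambda>s. indicator {0<..<L} s *\<^sub>R transported b (\<Phi> z (- s), t - s)
        - indicator {0<..<L} s *\<^sub>R (f (\<Phi> z (- s)) * - (1 - 2 * (t - s)) + g (\<Phi> z (- s)) * bump (t - s)))
      = (\<lambda>s. indicator {0<..<L} s *\<^sub>R w (\<Phi> z (- s), t - s))"
    by (auto simp: w_def fun_eq_iff algebra_simps)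
  finally show ?thesis
    unfolding S set_lebesgue_integral_def by (rule has_bochner_integral_integral_eq)
qed

text \<open>The outgoing formula for \<open>w\<close>, with \<open>backward_integral\<close> for the inner integrals. That lemma is
  applied to curves that spend no time in \<open>N0\<close>, the null set of \<open>\<Omega>\<close> where \<open>fs\<close> differs from \<open>f\<close> or
  its integral identity fails, and do not enter through \<open>N\<close>, the null set where the incoming trace
  differs from its Borel version \<open>b\<close>. The functions \<open>?\<eta>\<close> and \<open>?\<beta>\<close> detect the other curves,
  and \<open>null_along_outgoing\<close> shows that there are almost none.\<close>

lemma green_formula:
  fixes f fs g :: "'a \<Rightarrow> real"
  assumes out: "outgoing_boundary_measure M \<Phi> \<Omega> \<mu>p"
    and inc: "incoming_boundary_measure M \<Phi> \<Omega> \<mu>m"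
    and f: "integrable P f" and g: "integrable P g"
    and fs: "AE x in P. fs x = f x"
    and sharp: "AE x in P. \<forall>t1 t2. - tm x < ereal t1 \<and> t1 \<le> t2 \<and> ereal t2 < tp x \<longrightarrow>
       fs (\<Phi> x t1) - fs (\<Phi> x t2) = (LINT s:{t1..t2}|lebesgue. g (\<Phi> x s))"
    and tr: "integrable (completion \<mu>m) (trace_minus \<Phi> fs)"
  shows "has_bochner_integral (completion \<mu>p) (trace_plus \<Phi> fs)
    ((\<integral>y. trace_minus \<Phi> fs y \<partial>completion \<mu>m) - (\<integral>x. g x \<partial>P))"
proof -
  have space_p: "space \<mu>p = Gamma_plus \<Phi> \<Omega>"
    using out sets_eq_imp_space_eq[of \<mu>p "restrict_space borel (Gamma_plus \<Phi> \<Omega>)"]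
    by (auto simp: outgoing_boundary_measure_def space_restrict_space)
  have space_m: "space \<mu>m = Gamma_minus \<Phi> \<Omega>"
    using inc sets_eq_imp_space_eq[of \<mu>m "restrict_space borel (Gamma_minus \<Phi> \<Omega>)"]
    by (auto simp: incoming_boundary_measure_def space_restrict_space)
  have trm: "trace_minus \<Phi> fs \<in> borel_measurable (completion \<mu>m)"
    using tr by (rule borel_measurable_integrable)
  obtain b where b_meas: "b \<in> borel_measurable \<mu>m" and b_eq: "AE y in \<mu>m. trace_minus \<Phi> fs y = b y"
    using completion_ex_borel_measurable_real[OF trm] by blast
  have hb: "has_bochner_integral (completion \<mu>m) b (\<integral>y. trace_minus \<Phi> fs y \<partial>completion \<mu>m)"
    using tr by (intro has_bochner_integral_completion_AE[OF _ AE_completion[OF b_eq]]) (simp add: has_bochner_integral_iff)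
  then have b: "integrable \<mu>m b" "(\<integral>y. b y \<partial>\<mu>m) = (\<integral>y. trace_minus \<Phi> fs y \<partial>completion \<mu>m)"
    using b_meas by (simp_all add: has_bochner_integral_iff integrable_completion integral_completion)
  obtain N where N: "\<And>y. y \<in> Gamma_minus \<Phi> \<Omega> - N \<Longrightarrow> trace_minus \<Phi> fs y = b y" "N \<in> null_sets \<mu>m"
    using b_eq unfolding space_m[symmetric] by (rule AE_E3) blast
  have indN: "has_bochner_integral \<mu>m (indicator N :: 'a \<Rightarrow> real) 0"
    using N(2) has_bochner_integral_real_indicator[of N \<mu>m] by (simp add: null_sets_def measure_def)
  then have \<beta>: "integrable \<mu>m (indicator N :: 'a \<Rightarrow> real)" "(\<integral>y. (indicator N y :: real) \<partial>\<mu>m) = 0"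
    by (simp_all add: has_bochner_integral_iff)
  let ?\<beta> = "transported (indicator N)"
  have \<beta>_int: "integrable (P \<Otimes>\<^sub>M Q) ?\<beta>"
    by (rule integrable_transported[OF inc \<beta>(1)])
  have \<beta>_nonneg: "0 \<le> ?\<beta> z" if "z \<in> space (P \<Otimes>\<^sub>M Q)" for z
  proof (cases "tm (fst z) < ereal (snd z)")
    case True
    have z: "0 < snd z" "snd z < 1" using that by (auto simp: space_pair_measure)
    obtain r where r: "tm (fst z) = ereal r" "0 \<le> r" "r < snd z"
      using True tau_minus_nonneg[of "fst z"] by (cases "tm (fst z)") auto
    have "0 \<le> real_of_ereal (min (tm (fst z) + tp (fst z)) (ereal (1 - snd z) + tm (fst z)))"
      using r z tau_plus_nonneg[of "fst z"] by (intro real_of_ereal_pos) auto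
    then show ?thesis
      using True r z bump_nonneg[of "snd z - r"] by (simp add: transported_def case_prod_unfold)
  qed (simp add: transported_def case_prod_unfold)
  have "(\<integral>z. \<bar>?\<beta> z\<bar> \<partial>(P \<Otimes>\<^sub>M Q)) = (\<integral>z. ?\<beta> z \<partial>(P \<Otimes>\<^sub>M Q))"
    by (rule Bochner_Integration.integral_cong[OF refl]) (simp add: \<beta>_nonneg)
  also have "\<dots> = 0" using integral_transported[OF inc \<beta>(1)] \<beta>(2) by simp
  finally have \<beta>_null: "(\<integral>z. \<bar>?\<beta> z\<bar> \<partial>(P \<Otimes>\<^sub>M Q)) = 0" .
  define good where "good x \<longleftrightarrow> fs x = f x \<and> (\<forall>t1 t2. - tm x < ereal t1 \<and> t1 \<le> t2 \<and> ereal t2 < tp x \<longrightarrow>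
       fs (\<Phi> x t1) - fs (\<Phi> x t2) = (LINT s:{t1..t2}|lebesgue. g (\<Phi> x s)))" for x
  have "AE x in P. good x" using fs sharp by eventually_elim (simp add: good_def)
  then obtain N0 where N0': "\<And>x. x \<in> space P - N0 \<Longrightarrow> good x" and N0_null: "N0 \<in> null_sets P"
    by (rule AE_E3) blast
  have N0: "good x" if "x \<in> \<Omega>" "x \<notin> N0" for x
    using N0'[of x] that by simp
  have one: "has_bochner_integral Q (\<lambda>_. 1) (1::real)"
    using has_bochner_integral_unit_interval(1)[of "\<lambda>t. t" "\<lambda>_. 1"] by simp
  have linear: "has_bochner_integral Q (\<lambda>t. 1 - 2 * t) (0::real)"
  proof -
    have der: "((\<lambda>t. t - t\<^sup>2) has_real_derivative 1 - 2 * t) (at t)" for t :: real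
      by (auto intro!: derivative_eq_intros)
    show ?thesis
      using has_bochner_integral_unit_interval(1)[OF der] by (simp add: continuous_intros)
  qed
  note product = has_bochner_integral_product[OF PQ.pair_sigma_finite_axioms]
  have product': "has_bochner_integral (P \<Otimes>\<^sub>M Q) (\<lambda>(x, t). h x * k t) ((\<integral>x. h x \<partial>P) * v)"
    if "integrable P h" "has_bochner_integral Q k v" for h :: "'a \<Rightarrow> real" and k :: "real \<Rightarrow> real" and v
    using product[of h k] that by (auto simp: has_bochner_integral_iff)
  let ?\<eta> = "\<lambda>(x, t::real). indicator N0 x * (1::real)"
  have "has_bochner_integral P (indicator N0 :: 'a \<Rightarrow> real) 0"
    using N0_null has_bochner_integral_real_indicator[of N0 P] by (simp add: null_sets_def measure_def)
  then have \<eta>: "has_bochner_integral (P \<Otimes>\<^sub>M Q) ?\<eta> 0"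
    using product'[OF _ one, of "indicator N0"] by (simp add: has_bochner_integral_iff)
  then have \<eta>_int: "integrable (P \<Otimes>\<^sub>M Q) ?\<eta>" and \<eta>_null: "(\<integral>z. \<bar>?\<eta> z\<bar> \<partial>(P \<Otimes>\<^sub>M Q)) = 0"
    by (simp_all add: has_bochner_integral_iff case_prod_unfold)
  have g_int: "integrable (P \<Otimes>\<^sub>M Q) (\<lambda>(x, t). g x * 1)"
    using product'[OF g one] by (simp add: has_bochner_integral_iff)
  define w where "w = (\<lambda>(x, t). f x * (1 - 2 * t) - g x * bump t + transported b (x, t))"
  have "has_bochner_integral (P \<Otimes>\<^sub>M Q) (\<lambda>z. (case z of (x, t) \<Rightarrow> f x * (1 - 2 * t)) - (case z of (x, t) \<Rightarrow> g x * bump t) + transported b z)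
      ((\<integral>x. f x \<partial>P) * 0 - (\<integral>x. g x \<partial>P) * (1 / 6) + (\<integral>y. b y \<partial>\<mu>m) / 6)"
    using integrable_transported[OF inc b(1)] integral_transported[OF inc b(1)]
    by (intro has_bochner_integral_add has_bochner_integral_diff product'[OF f linear] product'[OF g has_integral_bump(1)])
      (simp add: has_bochner_integral_iff)
  then have w: "has_bochner_integral (P \<Otimes>\<^sub>M Q) w (((\<integral>y. b y \<partial>\<mu>m) - (\<integral>x. g x \<partial>P)) / 6)"
    by (simp add: w_def case_prod_unfold diff_divide_distrib)
  \<comment> \<open>one identity serves both terms of the outgoing formula: boundary points \<open>z\<close>, and points of \<open>\<Omega>\<close>
    at time \<open>1\<close>, where \<open>bump\<close> vanishes\<close>
  have key: "(LINT s:{s. 0 < s \<and> ereal s < min (tm z) (ereal t)}|lebesgue. w (\<Phi> z (- s), t - s))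
      = bump t * trace_plus \<Phi> fs z"
    if z: "z \<notin> \<Omega> \<or> t = 1" and t: "0 < t" "t \<le> 1" and pos: "0 < tm z"
      and G: "set_integrable lebesgue {s. 0 < s \<and> ereal s < min (tm z) (ereal t)} (\<lambda>s. g (\<Phi> z (- s)))"
      and a1: "AE s in lebesgue. 0 < s \<and> ereal s < min (tm z) (ereal t) \<longrightarrow> ?\<beta> (\<Phi> z (- s), t - s) = 0"
      and a2: "AE s in lebesgue. 0 < s \<and> ereal s < min (tm z) (ereal t) \<longrightarrow> ?\<eta> (\<Phi> z (- s), t - s) = 0"
    for z t
  proof -
    let ?S = "{s. 0 < s \<and> ereal s < min (tm z) (ereal t)}"
    have inside: "\<Phi> z (- s) \<in> \<Omega>" if "s \<in> ?S" for s
      using that less_tau_minusD[of s z] by auto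
    \<comment> \<open>almost every curve point avoids the exceptional sets, so at least one does\<close>
    obtain s0 where s0: "s0 \<in> ?S" "?\<beta> (\<Phi> z (- s0), t - s0) = 0" "?\<eta> (\<Phi> z (- s0), t - s0) = 0"
    proof -
      have "0 < min (tm z) (ereal t)" using pos t by simp
      then obtain L where L: "0 < L" "ereal L < min (tm z) (ereal t)"
        using ereal_dense2 by (metis ereal_less(2))
      have "AE s in lebesgue. s \<in> ?S \<longrightarrow> ?\<beta> (\<Phi> z (- s), t - s) = 0 \<and> ?\<eta> (\<Phi> z (- s), t - s) = 0"
        using a1 a2 by eventually_elim auto
      moreover have "{0<..<L} \<subseteq> ?S"
        using L by (auto intro: less_trans[of _ "ereal L"])
      ultimately have ae: "AE s in lebesgue. s \<in> {0<..<L} \<longrightarrow> ?\<beta> (\<Phi> z (- s), t - s) = 0 \<and> ?\<eta> (\<Phi> z (- s), t - s) = 0"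
        by (auto elim!: eventually_mono)
      have "\<not> (AE s in lebesgue. s \<notin> {0<..<L})"
      proof
        assume "AE s in lebesgue. s \<notin> {0<..<L}"
        then have "emeasure lebesgue {0<..<L} = 0"
          by (subst (asm) AE_iff_measurable[where N = "{0<..<L}"]) auto
        then show False using L(1) by simp
      qed
      then have "\<exists>s. s \<in> {0<..<L} \<and> ?\<beta> (\<Phi> z (- s), t - s) = 0 \<and> ?\<eta> (\<Phi> z (- s), t - s) = 0"
      proof (rule contrapos_np)
        assume none: "\<nexists>s. s \<in> {0<..<L} \<and> ?\<beta> (\<Phi> z (- s), t - s) = 0 \<and> ?\<eta> (\<Phi> z (- s), t - s) = 0"
        show "AE s in lebesgue. s \<notin> {0<..<L}"
          using ae by eventually_elim (use none in blast)
      qed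
      then obtain s where "s \<in> {0<..<L}" "?\<beta> (\<Phi> z (- s), t - s) = 0" "?\<eta> (\<Phi> z (- s), t - s) = 0"
        by blast
      with \<open>{0<..<L} \<subseteq> ?S\<close> show thesis by (intro that[of s]) (auto simp only: subset_iff)
    qed
    have "good (\<Phi> z (- s0))"
      using s0(3) N0 inside[OF s0(1)] by (auto simp: indicator_def split: if_splits)
    then have sharp0: "\<And>t1 t2. - tm (\<Phi> z (- s0)) < ereal t1 \<Longrightarrow> t1 \<le> t2 \<Longrightarrow> ereal t2 < tp (\<Phi> z (- s0)) \<Longrightarrow>
      fs (\<Phi> (\<Phi> z (- s0)) t1) - fs (\<Phi> (\<Phi> z (- s0)) t2) = (LINT s:{t1..t2}|lebesgue. g (\<Phi> (\<Phi> z (- s0)) s))"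
      unfolding good_def by blast
    have eq: "AE s in lebesgue. 0 < s \<and> ereal s < min (tm z) (ereal t) \<longrightarrow> f (\<Phi> z (- s)) = fs (\<Phi> z (- s))"
      using a2
    proof eventually_elim
      case (elim s)
      show ?case
      proof
        assume s: "0 < s \<and> ereal s < min (tm z) (ereal t)"
        with elim have "\<Phi> z (- s) \<notin> N0" by (auto simp: indicator_def split: if_splits)
        with N0[of "\<Phi> z (- s)"] inside[of s] s show "f (\<Phi> z (- s)) = fs (\<Phi> z (- s))"
          by (simp add: good_def)
      qed
    qed
    \<comment> \<open>\<open>?\<beta>\<close> is constant along the curve, and it is positive if the curve enters in \<open>N\<close>\<close>
    have bd: "b (entry z) = trace_minus \<Phi> fs (entry z)" if lt: "tm z < ereal t"
    proof -
      obtain r where r: "tm z = ereal r" "0 < r" "r < t" using lt pos by (cases "tm z") auto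
      have "?\<beta> (\<Phi> z (- s0), t - s0) = indicator N (entry z) * bump (t - r) / r"
        using transported_backward[OF z t, of s0 "indicator N"] s0(1) r lt by auto
      then have "entry z \<notin> N"
        using s0(2) r t bump_pos[of "t - r"] by (auto simp: indicator_def split: if_splits)
      moreover have "entry z \<in> Gamma_minus \<Phi> \<Omega>"
      proof -
        have 1: "ereal s0 + tm (\<Phi> z (- s0)) = tm z"
          using s0(1) by (intro tau_minus_flow) auto
        then have "tm (\<Phi> z (- s0)) = ereal (r - s0)" using r by (cases "tm (\<Phi> z (- s0))") auto
        then have "entry (\<Phi> z (- s0)) \<in> Gamma_minus \<Phi> \<Omega>" "entry (\<Phi> z (- s0)) = entry z"
          using entry_in_Gamma_minus[OF inside[OF s0(1)]] r by (auto simp: entry_def flow_flow)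
        then show ?thesis by simp
      qed
      ultimately show ?thesis using N(1) by simp
    qed
    show ?thesis
      unfolding w_def
      using s0(1)
      by (intro backward_integral[where f = f and fs = fs and g = g and b = b and ?s0.0 = s0,
            OF z t pos G _ _ sharp0 eq bd]) auto
  qed
  have w_int: "integrable (P \<Otimes>\<^sub>M Q) w"
    using w by (simp add: has_bochner_integral_iff)
  obtain J a c where J: "AE t in lebesgue_on {0<..<1}. has_iterated_integral (completion \<mu>p)
       (\<lambda>y. min (tm y) (ereal t)) (\<lambda>y s. w (\<Phi> y (- s), t - s)) (J t)"
    and a: "has_bochner_integral (lebesgue_on {0<..<1}) J a"
    and c: "has_iterated_integral P (\<lambda>x. min (tm x) (ereal 1)) (\<lambda>x s. w (\<Phi> x (- s), 1 - s)) c"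
    and sum: "(\<integral>z. w z \<partial>(P \<Otimes>\<^sub>M Q)) = a + c"
    using outgoingD[OF out w_int] by blast
  obtain Jg cg where "AE t in lebesgue_on {0<..<1}. has_iterated_integral (completion \<mu>p)
       (\<lambda>y. min (tm y) (ereal t)) (\<lambda>y s. case (\<Phi> y (- s), t - s) of (x, t) \<Rightarrow> g x * 1) (Jg t)"
    and "has_iterated_integral P (\<lambda>x. min (tm x) (ereal 1)) (\<lambda>x s. case (\<Phi> x (- s), 1 - s) of (x, t) \<Rightarrow> g x * 1) cg"
    using outgoingD[OF out g_int] by blast
  then have Jg: "AE t in lebesgue_on {0<..<1}. has_iterated_integral (completion \<mu>p)
       (\<lambda>y. min (tm y) (ereal t)) (\<lambda>y s. g (\<Phi> y (- s))) (Jg t)"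
    and cg: "has_iterated_integral P (\<lambda>x. min (tm x) (ereal 1)) (\<lambda>x s. g (\<Phi> x (- s))) cg"
    by simp_all
  note null_\<beta> = null_along_outgoing[OF out \<beta>_int \<beta>_null]
  note null_\<eta> = null_along_outgoing[OF out \<eta>_int \<eta>_null]
  have c0: "c = 0"
  proof -
    let ?I = "\<lambda>x. LINT s:{s. 0 < s \<and> ereal s < min (tm x) (ereal 1)}|lebesgue. w (\<Phi> x (- s), 1 - s)"
    have "AE x in P. ?I x = 0"
      using null_\<beta>(2) null_\<eta>(2) cg[unfolded has_iterated_integral_def, THEN conjunct1] AE_space
    proof eventually_elim
      case (elim x)
      have "0 < tm x" using elim(4) tau_minus_pos by simp
      from key[of x 1, OF _ _ _ this elim(3) elim(1) elim(2)] show ?case by (simp add: bump_def)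
    qed
    moreover have "has_bochner_integral P ?I c"
      using c by (simp add: has_iterated_integral_def)
    ultimately show ?thesis
      using has_bochner_integral_eq_AE[OF _ has_bochner_integral_zero[of P]] by blast
  qed
  have inner: "AE t in lebesgue_on {0<..<1}. has_bochner_integral (completion \<mu>p) (\<lambda>y. bump t * trace_plus \<Phi> fs y) (J t)"
    using J Jg null_\<beta>(1) null_\<eta>(1) AE_space
  proof eventually_elim
    case (elim t)
    have t: "0 < t" "t \<le> 1" using elim(5) by auto
    let ?I = "\<lambda>y. LINT s:{s. 0 < s \<and> ereal s < min (tm y) (ereal t)}|lebesgue. w (\<Phi> y (- s), t - s)"
    have "AE y in completion \<mu>p. ?I y = bump t * trace_plus \<Phi> fs y"
      using elim(3) elim(4) elim(2)[unfolded has_iterated_integral_def, THEN conjunct1] AE_space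
    proof eventually_elim
      case (elim y)
      have y: "y \<in> Gamma_plus \<Phi> \<Omega>" using elim(4) space_p by simp
      show ?case
        using Gamma_plus_props[OF y] t by (intro key elim) auto
    qed
    moreover have "has_bochner_integral (completion \<mu>p) ?I (J t)"
      using elim(1) by (simp add: has_iterated_integral_def)
    ultimately show ?case by (rule has_bochner_integral_completion_AE[rotated])
  qed
  have tp_int: "integrable (completion \<mu>p) (trace_plus \<Phi> fs)"
  proof -
    obtain t where t: "0 < t" "t < 1"
      "has_bochner_integral (completion \<mu>p) (\<lambda>y. bump t * trace_plus \<Phi> fs y) (J t)"
      using AE_unit_interval_ex[OF inner] by blast
    then have "integrable (completion \<mu>p) (\<lambda>y. bump t * trace_plus \<Phi> fs y)"
      by (simp add: has_bochner_integral_iff)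
    then show ?thesis
      using bump_pos[OF t(1,2)] by (subst (asm) integrable_mult_left_iff) simp
  qed
  let ?I = "\<integral>y. trace_plus \<Phi> fs y \<partial>completion \<mu>p"
  have "AE t in lebesgue_on {0<..<1}. J t = bump t * ?I"
    using inner by eventually_elim (simp add: has_bochner_integral_iff)
  then have "a = 1 / 6 * ?I"
    by (rule has_bochner_integral_eq_AE[OF a has_bochner_integral_mult_left[OF has_integral_bump(2)]])
  then have "?I = (\<integral>y. b y \<partial>\<mu>m) - (\<integral>x. g x \<partial>P)"
    using sum c0 w by (simp add: has_bochner_integral_iff)
  then show ?thesis using tp_int b(2) by (simp add: has_bochner_integral_iff)
qed

end

theorem proposition4p4:
  fixes M :: "(real ^ 'n) measure"
    and F :: "real ^ 'n \<Rightarrow> real ^ 'n"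
    and \<Phi> :: "real ^ 'n \<Rightarrow> real \<Rightarrow> real ^ 'n"
    and \<Omega> :: "(real ^ 'n) set"
    and \<mu>p \<mu>m :: "(real ^ 'n) measure"
    and f fs :: "real ^ 'n \<Rightarrow> real"
  assumes "radon_measure M"
    and "\<exists>C. C-lipschitz_on UNIV F"
    and "is_flow F \<Phi>"
    and "\<And>A t. A \<in> sets M \<Longrightarrow> emeasure M ((\<lambda>x. \<Phi> x t) ` A) = emeasure M A"
    and "open \<Omega>"
    and "outgoing_boundary_measure M \<Phi> \<Omega> \<mu>p"
    and "incoming_boundary_measure M \<Phi> \<Omega> \<mu>m"
    and "f \<in> dom_Tmax M \<Phi> \<Omega>"
    and "sharp_representative M \<Phi> \<Omega> f fs"
    and "integrable (completion \<mu>m) (trace_minus \<Phi> fs)"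
  shows "integrable (completion \<mu>p) (trace_plus \<Phi> fs) \<and>
    (\<integral>x. Tmax M \<Phi> \<Omega> f x \<partial>(restrict_space M \<Omega>)) =
      (\<integral>y. trace_minus \<Phi> fs y \<partial>(completion \<mu>m)) - (\<integral>y. trace_plus \<Phi> fs y \<partial>(completion \<mu>p))"
proof -
  obtain C where "C-lipschitz_on UNIV F" using assms(2) by (rule exE)
  then interpret flow_in_open_set \<Phi> \<Omega>
    by (rule flow_in_open_setI[OF _ assms(3,5)])
  interpret flow_in_measured_open_set \<Phi> \<Omega> M
    by unfold_locales (rule assms(1))
  have f: "integrable (restrict_space M \<Omega>) f" and ex: "\<exists>g. is_Tmax M \<Phi> \<Omega> f g"
    using assms(8) by (auto simp: dom_Tmax_def)
  from someI_ex[OF ex] have "is_Tmax M \<Phi> \<Omega> f (Tmax M \<Phi> \<Omega> f)"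
    unfolding Tmax_def .
  then have g: "integrable (restrict_space M \<Omega>) (Tmax M \<Phi> \<Omega> f)"
    by (simp add: is_Tmax_def)
  have "has_bochner_integral (completion \<mu>p) (trace_plus \<Phi> fs)
      ((\<integral>y. trace_minus \<Phi> fs y \<partial>completion \<mu>m) - (\<integral>x. Tmax M \<Phi> \<Omega> f x \<partial>restrict_space M \<Omega>))"
    by (rule green_formula[OF assms(6,7) f g _ _ assms(10)])
      (use assms(9) in \<open>simp_all only: sharp_representative_def\<close>)
  then show ?thesis by (simp add: has_bochner_integral_iff)
qed

end
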